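(* Let $d\ge 1$ be an integer, let $s\in(0,1)$ and let $\eta>0$ be such that $2s+\eta\notin\mathbb{N}$. Let $u:\mathbb{R}^d\times[0,\infty)\to\mathbb{R}$ be such that its even extension $\tilde u$ in the last variable belongs to the Schwartz space $\mathcal{S}(\mathbb{R}^{d+1})$. Then $$\int_{\mathbb{R}^{d}}\int_0^\infty |u(x,t)|^2\, e^{-\frac{|x|^2}{4t}}\, t^{\frac{2\eta-d-2}{2}}\,dt\,dx\;\le\; C\int_{\mathbb{R}^{d}}\int_0^\infty \left|(-\Delta_x-\partial_t)^{s}[u(x,t)]\right|^2 e^{-\frac{|x|^2}{4t}}\, t^{2s+\frac{2\eta-d-2}{2}}\,dt\,dx,$$ where $C$ is the positive constant $$C=\max_{j\in\{0,1,\dots,j_1+1\}}\left(\frac{\Gamma\big(\frac{\eta+j}{2}\big)}{\Gamma\big(\frac{2s+\eta+j}{2}\big)}\right)^2,$$ and $j_1$ is the smallest non-negative integer satisfying both $0\le j_1+s+\eta$ and $\eta(2s+\eta)\le j_1^2$.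
   Context: The even extension of $u:\mathbb{R}^d\times[0,\infty)\to\mathbb{R}$ is $\tilde u(x,t)=u(x,t)$ for $t\ge 0$ and $\tilde u(x,t)=u(x,-t)$ for $t<0$, $x\in\mathbb{R}^d$. $\mathcal{S}(\mathbb{R}^{n})$ is the Schwartz space of real-valued smooth rapidly decaying functions. Fractional power of the backward heat operator: for $s\in(0,1)$ and $u:\mathbb{R}^d\times[0,\infty)\to\mathbb{R}$, $$(-\Delta_x-\partial_t)^s[u(x,t)]=\frac{1}{\Gamma(-s)}\int_0^\infty\big(V(x,t,\tau)-u(x,t)\big)\frac{d\tau}{\tau^{1+s}},$$ where $V$ is the bounded solution of $\partial_\tau V=\Delta_x V+\partial_t V$ for $x\in\mathbb{R}^d$, $t>0$, $\tau>0$, with boundary condition $V(x,0,\tau)=\frac{1}{(4\pi\tau)^{d/2}}\int_{\mathbb{R}^d}e^{-\frac{|x-\overline x|^2}{4\tau}}u(\overline x,\tau)\,d\overline x$ for $x\in\mathbb{R}^d$, $\tau>0$, and initial condition $V(x,t,0)=u(x,t)$ for $x\in\mathbb{R}^d$, $t\ge0$; explicitly $$V(x,t,\tau)=\frac{1}{(4\pi\tau)^{d/2}}\int_{\mathbb{R}^d}e^{-\frac{|\overline x|^2}{4\tau}}\,u(x-\overline x,t+\tau)\,d\overline x .$$ $\Gamma$ is the Euler Gamma function. *)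

theory Defs
  imports "HOL-Analysis.Analysis"
begin

text \<open>
  Iterated partial derivatives along a list of directions; with directions in \<open>Basis\<close>
  these are the partial derivatives indexed by multi-indices.
\<close>
fun partials :: "'a list \<Rightarrow> ('a::euclidean_space \<Rightarrow> real) \<Rightarrow> 'a \<Rightarrow> real" where
  "partials [] f = f"
| "partials (b # bs) f = (\<lambda>x. frechet_derivative (partials bs f) (at x) b)"

text \<open>
  A function is smooth iff each of its iterated partial derivatives is (Frechet)
  differentiable everywhere.  This requirement also rules out the arbitrary value that
  \<open>frechet_derivative\<close> has at points of non-differentiability.
\<close>
definition smooth :: "('a::euclidean_space \<Rightarrow> real) \<Rightarrow> bool" where
  "smooth f \<longleftrightarrow> (\<forall>bs \<in> lists Basis. partials bs f differentiable_on UNIV)"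

definition schwartz_space :: "('a::euclidean_space \<Rightarrow> real) set" where
  "schwartz_space = {f. smooth f \<and>
     (\<forall>bs \<in> lists Basis. \<forall>N::nat. \<exists>C::real. \<forall>x. norm x ^ N * \<bar>partials bs f x\<bar> \<le> C)}"

text \<open>
  A function on \<open>\<real>\<^sup>d \<times> [0,\<infinity>)\<close> is represented by a total function of
  \<open>x\<close> and \<open>t\<close>; nothing below depends on its values at \<open>t < 0\<close>.
\<close>
definition even_extension ::
    "((real^'d) \<Rightarrow> real \<Rightarrow> real) \<Rightarrow> (real^'d) \<times> real \<Rightarrow> real" where
  "even_extension u = (\<lambda>(x, t). if t \<ge> 0 then u x t else u x (- t))"

text \<open>
  The bounded solution \<open>V\<close>, for \<open>\<tau> > 0\<close>, of the problem
  \<open>\<partial>\<^sub>\<tau> V = \<Delta>\<^sub>x V + \<partial>\<^sub>t V\<close> with \<open>V(x,t,0) = u(x,t)\<close>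
  and \<open>V(x,0,\<tau>)\<close> the heat flow at time \<open>\<tau>\<close> of \<open>u(\<cdot>,\<tau>)\<close>,
  given by its explicit formula.
\<close>
definition heat_extension ::
    "((real^'d) \<Rightarrow> real \<Rightarrow> real) \<Rightarrow> (real^'d) \<Rightarrow> real \<Rightarrow> real \<Rightarrow> real" where
  "heat_extension u x t \<tau> =
     1 / (4 * pi * \<tau>) powr (real CARD('d) / 2) *
     (LINT y|lborel. exp (- (norm y)\<^sup>2 / (4 * \<tau>)) * u (x - y) (t + \<tau>))"

definition frac_backward_heat ::
    "real \<Rightarrow> ((real^'d) \<Rightarrow> real \<Rightarrow> real) \<Rightarrow> (real^'d) \<Rightarrow> real \<Rightarrow> real" where
  "frac_backward_heat s u x t =
     1 / Gamma (- s) *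
     (LINT \<tau>:{0<..}|lborel. (heat_extension u x t \<tau> - u x t) / \<tau> powr (1 + s))"

definition hardy_index :: "real \<Rightarrow> real \<Rightarrow> nat" where
  "hardy_index s \<eta> =
     (LEAST j. 0 \<le> real j + s + \<eta> \<and> \<eta> * (2 * s + \<eta>) \<le> (real j)\<^sup>2)"

definition hardy_const :: "real \<Rightarrow> real \<Rightarrow> real" where
  "hardy_const s \<eta> =
     Max ((\<lambda>j::nat. (Gamma ((\<eta> + real j) / 2) / Gamma ((2 * s + \<eta> + real j) / 2))\<^sup>2)
            ` {0..hardy_index s \<eta> + 1})"

end

theory Submission
  imports Defs "HOL-Probability.Distributions"
begin

text \<open>
  Let \<open>G\<^sub>t\<close> be the heat kernel, \<open>P\<^sub>\<tau>\<close> the heat semigroup in \<open>x\<close>, and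
  \<open>(T\<^sub>\<tau> u)(x,t) = (P\<^sub>\<tau> u(\<cdot>,t+\<tau>))(x)\<close>, so that \<open>V(x,t,\<tau>) = (T\<^sub>\<tau> u)(x,t)\<close>.  The weight
  \<open>e\<^bsup>-|x|^2/4t\<^esup> t\<^bsup>-d/2\<^esup>\<close> is \<open>(4\<pi>)\<^bsup>d/2\<^esup> G\<^sub>t(x)\<close>.  With \<open>f = (-\<Delta>-\<partial>\<^sub>t)\<^sup>s u\<close> and
  \<open>\<parallel>g\<parallel>\<^sub>t\<close> the norm of \<open>L\<^sup>2(G\<^sub>t dx)\<close>, the claim is therefore that
  \<open>\<integral> t\<^bsup>\<eta>-1\<^esup> \<parallel>u(\<cdot>,t)\<parallel>\<^sub>t\<^sup>2 dt \<le> C \<integral> t\<^bsup>2s+\<eta>-1\<^esup> \<parallel>f(\<cdot>,t)\<parallel>\<^sub>t\<^sup>2 dt\<close>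
  (\<open>gaussian_weighted_norm\<close>).

  The operators \<open>T\<^sub>\<tau>\<close> form a semigroup, and \<open>f\<close> is a Marchaud derivative of order \<open>s\<close> along its
  orbits: applying \<open>T\<^sub>\<sigma>\<close> to \<open>f\<close> gives the Marchaud derivative at \<open>\<sigma>\<close> of the scalar function
  \<open>\<phi>(\<sigma>) = V(x,t,\<sigma>)\<close> (\<open>heat_average_frac_power\<close>).  Inverting that derivative on the half-line
  (\<open>marchaud_inversion\<close>) yields \<open>u = \<Gamma>(s)\<^bsup>-1\<^esup> \<integral> \<sigma>\<^bsup>s-1\<^esup> T\<^sub>\<sigma> f d\<sigma>\<close>, of which only the
  resulting bound for \<open>|u|\<close> is kept (\<open>pointwise_bound\<close>).  The inversion requires \<open>\<phi>\<close> to be the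
  tail integral of an integrable function (\<open>heat_flow_eq_tail_integral\<close>).  This follows from
  \<open>\<phi>(\<sigma>) = \<integral> G\<^sub>1(z) u(x - \<surd>\<sigma> z, t+\<sigma>) dz\<close>: for each \<open>z\<close> the integrand tends to \<open>0\<close> as
  \<open>\<sigma> \<rightarrow> \<infinity>\<close>, and its derivative in \<open>\<sigma>\<close> is \<open>O(\<sigma>\<^bsup>-1/2\<^esup>)\<close> at \<open>0\<close> and decays at infinity
  because the gradient of \<open>u\<close> does.

  The Hardy inequality is now a Schur test (\<open>fractional_Hardy\<close>).  By the Cauchy-Schwarz inequality
  for the probability density \<open>G\<^sub>\<sigma>\<close> and \<open>G\<^sub>t * G\<^sub>\<sigma> = G\<^bsub>t+\<sigma>\<^esub>\<close>, one has
  \<open>\<parallel>(T\<^sub>\<sigma> f)(\<cdot>,t)\<parallel>\<^sub>t \<le> \<parallel>f(\<cdot>,t+\<sigma>)\<parallel>\<^bsub>t+\<sigma>\<^esub>\<close>, so that \<open>\<parallel>u(\<cdot>,t)\<parallel>\<^sub>t\<close> is dominated by the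
  Weyl fractional integral of \<open>\<parallel>f(\<cdot>,t)\<parallel>\<^sub>t\<close>.  Testing with the power \<open>t\<^bsup>-s-\<eta>/2\<^esup>\<close>, which the
  Weyl integral maps to a multiple of \<open>t\<^bsup>-\<eta>/2\<^esup>\<close>, gives the constant
  \<open>(\<Gamma>(\<eta>/2) / \<Gamma>(s+\<eta>/2))\<^sup>2\<close>.  This is the entry \<open>j = 0\<close> of the maximum defining \<open>C\<close>.
\<close>


section \<open>Lebesgue integrals under affine maps and on products\<close>

lemma nn_integral_shift:
  fixes f :: "'a::euclidean_space \<Rightarrow> ennreal"
  assumes [measurable]: "f \<in> borel_measurable borel"
  shows "(\<integral>\<^sup>+x. f (c + x) \<partial>lborel) = (\<integral>\<^sup>+x. f x \<partial>lborel)"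
proof -
  have "(\<integral>\<^sup>+x. f x \<partial>lborel) = (\<integral>\<^sup>+x. f x \<partial>distr lborel borel ((+) c))"
    by (simp add: lborel_distr_plus)
  also have "\<dots> = (\<integral>\<^sup>+x. f (c + x) \<partial>lborel)"
    by (subst nn_integral_distr) auto
  finally show ?thesis by simp
qed

lemma nn_integral_scale:
  fixes f :: "'a::euclidean_space \<Rightarrow> ennreal"
  assumes [measurable]: "f \<in> borel_measurable borel" and "c \<noteq> 0"
  shows "(\<integral>\<^sup>+x. f x \<partial>lborel) = ennreal (\<bar>c\<bar> ^ DIM('a)) * (\<integral>\<^sup>+x. f (c *\<^sub>R x) \<partial>lborel)"
  by (subst lborel_affine[OF assms(2), of 0])
     (simp add: nn_integral_density nn_integral_distr nn_integral_cmult)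

lemma nn_integral_reflect:
  fixes f :: "'a::euclidean_space \<Rightarrow> ennreal"
  assumes [measurable]: "f \<in> borel_measurable borel"
  shows "(\<integral>\<^sup>+y. f (x - y) \<partial>lborel) = (\<integral>\<^sup>+y. f y \<partial>lborel)"
proof -
  have "(\<integral>\<^sup>+y. f (x - y) \<partial>lborel) = (\<integral>\<^sup>+y. f (x + - y) \<partial>lborel)"
    by simp
  also have "\<dots> = (\<integral>\<^sup>+y. f (x + y) \<partial>lborel)"
    by (subst (2) nn_integral_scale[of _ "-1"]) simp_all
  also have "\<dots> = (\<integral>\<^sup>+y. f y \<partial>lborel)"
    by (rule nn_integral_shift) simp
  finally show ?thesis .
qed

lemma integral_shift:
  fixes f :: "'a::euclidean_space \<Rightarrow> real"
  assumes [measurable]: "f \<in> borel_measurable borel"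
  shows "(LINT x|lborel. f (c + x)) = (LINT x|lborel. f x)"
proof -
  have "(LINT x|lborel. f x) = (LINT x|distr lborel borel ((+) c). f x)"
    by (simp add: lborel_distr_plus)
  also have "\<dots> = (LINT x|lborel. f (c + x))"
    by (rule integral_distr) auto
  finally show ?thesis by simp
qed

lemma integral_uminus:
  fixes f :: "'a::euclidean_space \<Rightarrow> real"
  assumes [measurable]: "f \<in> borel_measurable borel"
  shows "(LINT x|lborel. f (- x)) = (LINT x|lborel. f x)"
  by (subst (2) lborel_affine[of "-1" 0]) (simp_all add: density_1 integral_distr)

text \<open>
  Along the heat extension the integrands have a factor with Gaussian decay in the space variable and
  an integrable power weight in the time variable; for these it justifies Fubini's theorem.
\<close>
lemma integrable_product_bound:
  fixes f :: "'a::euclidean_space \<times> 'b::euclidean_space \<Rightarrow> real"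
  assumes f: "f \<in> borel_measurable (lborel \<Otimes>\<^sub>M lborel)"
    and a: "integrable lborel a" and b: "integrable lborel b"
    and bound: "\<And>x y. \<bar>f (x, y)\<bar> \<le> a x * b y"
  shows "integrable (lborel \<Otimes>\<^sub>M lborel) f"
proof (rule integrableI_bounded)
  note f[measurable]
  have [measurable]: "a \<in> borel_measurable borel" "b \<in> borel_measurable borel"
    using a b by auto
  have "(\<integral>\<^sup>+p. ennreal (norm (f p)) \<partial>(lborel \<Otimes>\<^sub>M lborel)) = (\<integral>\<^sup>+x. \<integral>\<^sup>+y. ennreal (norm (f (x, y))) \<partial>lborel \<partial>lborel)"
    by (rule lborel.nn_integral_fst[symmetric]) measurable
  also have "\<dots> \<le> (\<integral>\<^sup>+x. \<integral>\<^sup>+y. ennreal (norm (a x)) * ennreal (norm (b y)) \<partial>lborel \<partial>lborel)"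
  proof (intro nn_integral_mono)
    fix x y
    have "norm (f (x, y)) \<le> norm (a x) * norm (b y)"
      using bound[of x y] unfolding real_norm_def abs_mult[symmetric] by linarith
    then show "ennreal (norm (f (x, y))) \<le> ennreal (norm (a x)) * ennreal (norm (b y))"
      by (subst ennreal_mult'[symmetric]) (auto intro: ennreal_leI)
  qed
  also have "\<dots> = (\<integral>\<^sup>+x. ennreal (norm (a x)) \<partial>lborel) * (\<integral>\<^sup>+y. ennreal (norm (b y)) \<partial>lborel)"
    by (simp add: nn_integral_cmult nn_integral_multc)
  also have "\<dots> < \<infinity>"
    using a b unfolding integrable_iff_bounded by (simp add: ennreal_mult_less_top)
  finally show "(\<integral>\<^sup>+p. ennreal (norm (f p)) \<partial>(lborel \<Otimes>\<^sub>M lborel)) < \<infinity>" .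
qed (fact f)

text \<open>
  The splitting of the weight \<open>\<surd>(p q)\<close> serves two ends: with \<open>p = q\<close> a probability density it
  is Jensen's inequality for the square, and with \<open>p\<close>, \<open>q\<close> differing by a power it is the
  Schur test.
\<close>
lemma weighted_Cauchy_Schwarz:
  assumes [measurable]: "p \<in> borel_measurable M" "q \<in> borel_measurable M" "A \<in> borel_measurable M"
    and nonneg: "\<And>x. 0 \<le> p x" "\<And>x. 0 \<le> q x"
  shows "(\<integral>\<^sup>+x. ennreal (sqrt (p x * q x)) * A x \<partial>M)\<^sup>2 \<le> (\<integral>\<^sup>+x. ennreal (p x) \<partial>M) * (\<integral>\<^sup>+x. ennreal (q x) * (A x)\<^sup>2 \<partial>M)"
proof -
  have "(\<integral>\<^sup>+x. ennreal (sqrt (p x)) * (ennreal (sqrt (q x)) * A x) \<partial>M)\<^sup>2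
    \<le> (\<integral>\<^sup>+x. (ennreal (sqrt (p x)))\<^sup>2 \<partial>M) * (\<integral>\<^sup>+x. (ennreal (sqrt (q x)) * A x)\<^sup>2 \<partial>M)"
    by (rule Cauchy_Schwarz_nn_integral) measurable
  then show ?thesis
    using nonneg by (simp add: real_sqrt_mult ennreal_mult' mult.assoc power_mult_distrib ennreal_power)
qed

section \<open>Power weights and Euler integrals\<close>

text \<open>
  Cutting the power off at \<open>0\<close> turns integrals over \<open>(0,\<infinity>)\<close> and over \<open>(0,r)\<close> into integrals over
  the whole line: \<open>ppow a t * ppow b (r - t)\<close> is supported in \<open>0 < t < r\<close>.
\<close>
definition ppow :: "real \<Rightarrow> real \<Rightarrow> real" where
  "ppow a t = (if 0 < t then t powr a else 0)"

lemma ppow_measurable [measurable]: "ppow a \<in> borel_measurable borel"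
  unfolding ppow_def[abs_def] by measurable

lemma ppow_nonneg [simp]: "0 \<le> ppow a t"
  by (simp add: ppow_def)

lemma ppow_pos: "0 < t \<Longrightarrow> ppow a t = t powr a"
  by (simp add: ppow_def)

lemma ppow_nonpos: "t \<le> 0 \<Longrightarrow> ppow a t = 0"
  by (simp add: ppow_def)

lemma ppow_scale: "0 < c \<Longrightarrow> ppow a (c * t) = c powr a * ppow a t"
  by (simp add: ppow_def powr_mult zero_less_mult_iff)

lemma nn_integral_Gamma:
  assumes "0 < a" "0 < c"
  shows "(\<integral>\<^sup>+w. ennreal (ppow (a - 1) w * exp (- (c * w))) \<partial>lborel) = ennreal (Gamma a * c powr (- a))"
proof -
  have "ennreal (Gamma a) = (\<integral>\<^sup>+t. ennreal (indicator {0..} t * t powr (a - 1) / exp t) \<partial>lborel)"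
    by (rule Gamma_conv_nn_integral_real[OF assms(1)])
  also have "\<dots> = (\<integral>\<^sup>+w. ennreal (ppow (a - 1) w * exp (- w)) \<partial>lborel)"
    by (intro nn_integral_cong) (auto simp: ppow_def exp_minus field_simps split: split_indicator)
  also have "\<dots> = ennreal c * (\<integral>\<^sup>+w. ennreal (ppow (a - 1) (c * w) * exp (- (c * w))) \<partial>lborel)"
    using assms by (subst nn_integral_scale[of _ c]) simp_all
  also have "\<dots> = ennreal c * (\<integral>\<^sup>+w. ennreal (c powr (a - 1)) * ennreal (ppow (a - 1) w * exp (- (c * w))) \<partial>lborel)"
    unfolding ppow_scale[OF assms(2)] by (simp add: ennreal_mult'[symmetric] mult.assoc)
  also have "\<dots> = (ennreal c * ennreal (c powr (a - 1))) * (\<integral>\<^sup>+w. ennreal (ppow (a - 1) w * exp (- (c * w))) \<partial>lborel)"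
    by (subst nn_integral_cmult) (simp_all only: mult.assoc, measurable)
  also have "ennreal c * ennreal (c powr (a - 1)) = ennreal (c powr a)"
    using assms by (simp add: ennreal_mult'[symmetric] powr_mult_base)
  finally have "ennreal (c powr (- a)) * ennreal (Gamma a) =
    ennreal (c powr (- a)) * (ennreal (c powr a) * (\<integral>\<^sup>+w. ennreal (ppow (a - 1) w * exp (- (c * w))) \<partial>lborel))"
    by simp
  also have "\<dots> = (\<integral>\<^sup>+w. ennreal (ppow (a - 1) w * exp (- (c * w))) \<partial>lborel)"
    using assms by (simp add: mult.assoc[symmetric] ennreal_mult'[symmetric] powr_add[symmetric])
  finally show ?thesis
    by (simp add: ennreal_mult''[symmetric] mult.commute ennreal_mult'[symmetric])
qed

lemma nn_integral_Beta:
  assumes "0 < a" "0 < b" "0 < r"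
  shows "(\<integral>\<^sup>+t. ennreal (ppow (a - 1) t * ppow (b - 1) (r - t)) \<partial>lborel)
    = ennreal (Beta a b * r powr (a + b - 1))"
proof -
  have B: "(\<integral>\<^sup>+t. ennreal (ppow (a - 1) t * ppow (b - 1) (1 - t)) \<partial>lborel) = ennreal (Beta a b)"
  proof -
    have "(\<integral>\<^sup>+t. ennreal (indicator {0..1} t * (t powr (a - 1) * (1 - t) powr (b - 1))) \<partial>lborel) = ennreal (Beta a b)"
      using nn_integral_has_integral_lebesgue[OF _ has_integral_Beta_real[OF assms(1,2)]]
      by simp
    also have "(\<integral>\<^sup>+t. ennreal (indicator {0..1} t * (t powr (a - 1) * (1 - t) powr (b - 1))) \<partial>lborel)
      = (\<integral>\<^sup>+t. ennreal (ppow (a - 1) t * ppow (b - 1) (1 - t)) \<partial>lborel)"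
      by (intro nn_integral_cong) (auto simp: ppow_def split: split_indicator)
    finally show ?thesis .
  qed
  have "(\<integral>\<^sup>+t. ennreal (ppow (a - 1) t * ppow (b - 1) (r - t)) \<partial>lborel) =
    ennreal r * (\<integral>\<^sup>+t. ennreal (ppow (a - 1) (r * t) * ppow (b - 1) (r * (1 - t))) \<partial>lborel)"
    using assms by (subst nn_integral_scale[of _ r]) (simp_all add: algebra_simps)
  also have "\<dots> = ennreal r * (\<integral>\<^sup>+t. ennreal (r powr (a + b - 2)) * ennreal (ppow (a - 1) t * ppow (b - 1) (1 - t)) \<partial>lborel)"
  proof -
    have "r powr (a - 1) * r powr (b - 1) = r powr (a + b - 2)"
      by (simp add: powr_add[symmetric])
    then have E: "r powr (a - 1) * x * (r powr (b - 1) * y) = r powr (a + b - 2) * (x * y)" for x y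
      by (metis mult.assoc mult.left_commute)
    then show ?thesis
      unfolding ppow_scale[OF assms(3)] E by (simp add: ennreal_mult'[symmetric])
  qed
  also have "\<dots> = ennreal r * ennreal (r powr (a + b - 2)) * ennreal (Beta a b)"
    by (simp add: nn_integral_cmult B mult.assoc)
  also have "\<dots> = ennreal (Beta a b * r powr (a + b - 1))"
    using assms by (simp add: ennreal_mult'[symmetric] ennreal_mult''[symmetric] powr_mult_base mult_ac)
  finally show ?thesis .
qed

text \<open>
  This is the Weyl fractional integral of a power.  Writing \<open>(t + \<tau>)\<^bsup>-l\<^esup>\<close> as
  \<open>\<Gamma>(l)\<^bsup>-1\<^esup> \<integral> w\<^bsup>l-1\<^esup> e\<^bsup>-(t+\<tau>)w\<^esup> dw\<close> separates the variables, and both remaining integrals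
  are Gamma integrals.
\<close>
lemma nn_integral_Beta_Weyl:
  assumes "0 < s" "s < l" "0 < t"
  shows "(\<integral>\<^sup>+\<tau>. ennreal (ppow (s - 1) \<tau> * (t + \<tau>) powr (- l)) \<partial>lborel)
    = ennreal (Beta s (l - s) * t powr (s - l))"
proof -
  have "ennreal (Gamma l) * (\<integral>\<^sup>+\<tau>. ennreal (ppow (s - 1) \<tau> * (t + \<tau>) powr (- l)) \<partial>lborel)
    = (\<integral>\<^sup>+\<tau>. ennreal (ppow (s - 1) \<tau>) * ennreal (Gamma l * (t + \<tau>) powr (- l)) \<partial>lborel)"
    by (subst nn_integral_cmult[symmetric])
       (use assms in \<open>auto intro!: nn_integral_cong simp: ennreal_mult'[symmetric] ennreal_mult''[symmetric] mult_ac\<close>)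
  also have "\<dots> = (\<integral>\<^sup>+\<tau>. (\<integral>\<^sup>+w. ennreal (ppow (s - 1) \<tau> * (ppow (l - 1) w * exp (- ((t + \<tau>) * w)))) \<partial>lborel) \<partial>lborel)"
  proof (intro nn_integral_cong)
    fix \<tau> :: real
    show "ennreal (ppow (s - 1) \<tau>) * ennreal (Gamma l * (t + \<tau>) powr (- l)) =
      (\<integral>\<^sup>+w. ennreal (ppow (s - 1) \<tau> * (ppow (l - 1) w * exp (- ((t + \<tau>) * w)))) \<partial>lborel)"
    proof (cases "0 < \<tau>")
      case True
      then show ?thesis
        using assms by (subst nn_integral_Gamma[symmetric])
          (simp_all add: nn_integral_cmult[symmetric] ennreal_mult'[symmetric])
    qed (simp add: ppow_def)
  qed
  also have "\<dots> = (\<integral>\<^sup>+w. (\<integral>\<^sup>+\<tau>. ennreal (ppow (s - 1) \<tau> * (ppow (l - 1) w * exp (- ((t + \<tau>) * w)))) \<partial>lborel) \<partial>lborel)"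
    by (rule lborel_pair.Fubini') measurable
  also have "\<dots> = (\<integral>\<^sup>+w. ennreal (Gamma s) * ennreal (ppow ((l - s) - 1) w * exp (- (t * w))) \<partial>lborel)"
  proof (intro nn_integral_cong)
    fix w :: real
    show "(\<integral>\<^sup>+\<tau>. ennreal (ppow (s - 1) \<tau> * (ppow (l - 1) w * exp (- ((t + \<tau>) * w)))) \<partial>lborel)
      = ennreal (Gamma s) * ennreal (ppow ((l - s) - 1) w * exp (- (t * w)))"
    proof (cases "0 < w")
      case True
      have "(\<integral>\<^sup>+\<tau>. ennreal (ppow (s - 1) \<tau> * (ppow (l - 1) w * exp (- ((t + \<tau>) * w)))) \<partial>lborel)
        = (\<integral>\<^sup>+\<tau>. ennreal (w powr (l - 1) * exp (- (t * w))) * ennreal (ppow (s - 1) \<tau> * exp (- (w * \<tau>))) \<partial>lborel)"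
        using True by (intro nn_integral_cong)
          (simp add: ennreal_mult'[symmetric] ppow_pos mult_exp_exp algebra_simps)
      also have "\<dots> = ennreal (w powr (l - 1) * exp (- (t * w))) * ennreal (Gamma s * w powr (- s))"
        using True assms by (simp add: nn_integral_cmult nn_integral_Gamma)
      also have "\<dots> = ennreal (Gamma s) * ennreal (ppow ((l - s) - 1) w * exp (- (t * w)))"
        using True assms
        by (simp add: ennreal_mult'[symmetric] ppow_pos mult_ac powr_add[symmetric])
           (simp add: ennreal_mult''[symmetric] ennreal_mult'[symmetric] powr_diff powr_minus field_simps)
      finally show ?thesis .
    qed (simp add: ppow_def)
  qed
  also have "\<dots> = ennreal (Gamma s) * ennreal (Gamma (l - s) * t powr (- (l - s)))"
    using assms by (simp add: nn_integral_cmult nn_integral_Gamma)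
  finally have *: "ennreal (Gamma l) * (\<integral>\<^sup>+\<tau>. ennreal (ppow (s - 1) \<tau> * (t + \<tau>) powr (- l)) \<partial>lborel)
    = ennreal (Gamma s * Gamma (l - s) * t powr (s - l))"
    using assms by (simp add: ennreal_mult'[symmetric] mult.assoc)
  define I where "I = (\<integral>\<^sup>+\<tau>. ennreal (ppow (s - 1) \<tau> * (t + \<tau>) powr (- l)) \<partial>lborel)"
  have G: "Gamma l > 0" using assms by simp
  have "I = ennreal (inverse (Gamma l)) * (ennreal (Gamma l) * I)"
    using G by (simp add: mult.assoc[symmetric] ennreal_mult'[symmetric] del: Gamma_real_pos)
  also have "\<dots> = ennreal (inverse (Gamma l) * (Gamma s * Gamma (l - s) * t powr (s - l)))"
    unfolding I_def * using G by (intro ennreal_mult'[symmetric]) simp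
  also have "inverse (Gamma l) * (Gamma s * Gamma (l - s) * t powr (s - l)) = Beta s (l - s) * t powr (s - l)"
    by (simp add: Beta_def field_simps)
  finally show ?thesis unfolding I_def .
qed

lemma nn_integral_ppow_tail:
  assumes "0 < s" "0 < r"
  shows "(\<integral>\<^sup>+\<tau>. ennreal (ppow (-1 - s) \<tau>) * indicator {r..} \<tau> \<partial>lborel) = ennreal (r powr (- s) / s)"
proof -
  have "(\<integral>\<^sup>+\<tau>. ennreal (ppow (-1 - s) \<tau>) * indicator {r..} \<tau> \<partial>lborel) = ennreal (0 - (- (r powr (- s) / s)))"
  proof (rule nn_integral_FTC_atLeast)
    fix x assume "r \<le> x"
    then show "((\<lambda>x. - (x powr (- s) / s)) has_real_derivative ppow (-1 - s) x) (at x)"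
      using assms by (auto intro!: derivative_eq_intros simp: ppow_pos powr_diff powr_minus field_simps)
    show "0 \<le> ppow (-1 - s) x" by simp
  next
    have "((\<lambda>x. - (x powr (- s) / s)) \<longlongrightarrow> - (0 / s)) at_top"
      using assms by (intro tendsto_intros tendsto_neg_powr filterlim_ident) auto
    then show "((\<lambda>x. - (x powr (- s) / s)) \<longlongrightarrow> 0) at_top" by simp
  qed measurable
  then show ?thesis by simp
qed

text \<open>
  Majorant for the integral that defines the fractional power: \<open>ppow (-1 - s)\<close> times an increment
  of size \<open>min \<tau> 1\<close>, which is comparable to \<open>\<tau> / (1 + \<tau>)\<close>.
\<close>
lemma integrable_Weyl_weight:
  assumes "0 < s" "s < 1"
  shows "integrable lborel (\<lambda>\<tau>. ppow (- s) \<tau> * (1 + \<tau>) powr (- 1))"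
  using nn_integral_Beta_Weyl[of "1 - s" 1 1] assms by (intro integrableI_bounded) (auto simp: abs_mult)

lemma integrable_curve_majorant:
  "integrable lborel (\<lambda>r. ppow (1/2 - 1) r * (1 + r) powr (- 1))"
  using nn_integral_Beta_Weyl[of "1/2" 1 1] by (intro integrableI_bounded) auto

section \<open>The heat kernel\<close>

definition heat_kernel :: "real \<Rightarrow> 'a::euclidean_space \<Rightarrow> real" where
  "heat_kernel t x = exp (- (norm x)\<^sup>2 / (4 * t)) / (4 * pi * t) powr (real DIM('a) / 2)"

lemma heat_kernel_measurable [measurable (raw)]:
  assumes [measurable]: "f \<in> borel_measurable M" "g \<in> borel_measurable M"
  shows "(\<lambda>w. heat_kernel (f w) (g w)) \<in> borel_measurable M"
  unfolding heat_kernel_def by measurable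

lemma heat_kernel_nonneg [simp]: "0 \<le> heat_kernel t x"
  by (simp add: heat_kernel_def)

lemma heat_kernel_minus [simp]: "heat_kernel t (- x) = heat_kernel t x"
  by (simp add: heat_kernel_def)

text \<open>
  The kernel of time \<open>t\<close> is the Gaussian density of variance \<open>2t\<close> in each coordinate, which
  reduces its total mass to the one-dimensional normal distribution.
\<close>
lemma heat_kernel_eq_prod:
  fixes x :: "'a::euclidean_space"
  assumes "0 < t"
  shows "heat_kernel t x = (\<Prod>b\<in>Basis. normal_density 0 (sqrt (2 * t)) (x \<bullet> b))"
proof -
  have n: "normal_density 0 (sqrt (2 * t)) y = exp (- y\<^sup>2 / (4 * t)) / (4 * pi * t) powr (1 / 2)" for y :: real
    using assms by (simp add: normal_density_def powr_half_sqrt mult_ac)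
  have "(\<Prod>b\<in>Basis. normal_density 0 (sqrt (2 * t)) (x \<bullet> b)) =
    (\<Prod>b\<in>Basis. exp (- (x \<bullet> b)\<^sup>2 / (4 * t))) / ((4 * pi * t) powr (1 / 2)) ^ DIM('a)"
    by (simp add: n prod_dividef)
  also have "(\<Prod>b\<in>Basis. exp (- (x \<bullet> b)\<^sup>2 / (4 * t))) = exp (- (norm x)\<^sup>2 / (4 * t))"
    unfolding exp_sum[OF finite_Basis, symmetric] power2_norm_eq_inner
    by (subst euclidean_inner) (simp add: sum_divide_distrib sum_negf power2_eq_square)
  also have "((4 * pi * t) powr (1 / 2)) ^ DIM('a) = (4 * pi * t) powr (real DIM('a) / 2)"
    using assms by (simp add: powr_realpow[symmetric] powr_powr)
  finally show ?thesis by (simp add: heat_kernel_def)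
qed

lemma nn_integral_heat_kernel:
  assumes "0 < t"
  shows "(\<integral>\<^sup>+x. ennreal (heat_kernel t (x::'a::euclidean_space)) \<partial>lborel) = 1"
proof -
  have "(\<integral>\<^sup>+x. ennreal (heat_kernel t (x::'a)) \<partial>lborel)
    = (\<integral>\<^sup>+x. (\<Prod>b\<in>Basis. ennreal (normal_density 0 (sqrt (2 * t)) ((x::'a) \<bullet> b))) \<partial>lborel)"
    using assms by (simp add: heat_kernel_eq_prod prod_ennreal)
  also have "\<dots> = (\<Prod>b\<in>(Basis::'a set). (\<integral>\<^sup>+x. ennreal (normal_density 0 (sqrt (2 * t)) x) \<partial>lborel))"
    by (rule nn_integral_lborel_prod) simp_all
  also have "(\<integral>\<^sup>+x. ennreal (normal_density 0 (sqrt (2 * t)) x) \<partial>lborel) = 1"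
    using assms by (subst nn_integral_eq_integral) (auto intro: integrable_normal_density)
  finally show ?thesis by simp
qed

lemma has_bochner_integral_heat_kernel:
  assumes "0 < t"
  shows "has_bochner_integral lborel (heat_kernel t :: 'a::euclidean_space \<Rightarrow> real) 1"
  using nn_integral_heat_kernel[OF assms, where 'a='a]
  by (intro has_bochner_integral_nn_integral) auto


text \<open>
  Completing the square in \<open>y\<close>.  The second factor on the right is a translated kernel, with
  \<open>1/t + 1/\<tau>\<close> as the inverse of its time, so integration over \<open>y\<close> leaves the first factor.
\<close>
lemma heat_kernel_mult:
  fixes y z :: "'a::euclidean_space"
  assumes "0 < t" "0 < \<tau>"
  shows "heat_kernel t (z + y) * heat_kernel \<tau> y =
    heat_kernel (t + \<tau>) z * heat_kernel (t * \<tau> / (t + \<tau>)) ((\<tau> / (t + \<tau>)) *\<^sub>R z + y)"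
proof -
  define p where "p = real DIM('a) / 2"
  have [simp]: "t + \<tau> \<noteq> 0" using assms by simp
  have c: "(4 * pi * t) powr p * (4 * pi * \<tau>) powr p
    = (4 * pi * (t + \<tau>)) powr p * (4 * pi * (t * \<tau> / (t + \<tau>))) powr p"
  proof -
    have "(4 * pi * t) * (4 * pi * \<tau>) = (4 * pi * (t + \<tau>)) * (4 * pi * (t * \<tau> / (t + \<tau>)))"
      by simp
    then show ?thesis
      using assms by (subst (1 2) powr_mult[symmetric]) (simp_all only: mult_pos_pos pi_gt_zero less_imp_le divide_pos_pos add_pos_pos zero_less_numeral mult_nonneg_nonneg divide_nonneg_nonneg)
  qed
  define a b e where "a = z \<bullet> z" and "b = z \<bullet> y" and "e = y \<bullet> y"
  have n1: "(norm (z + y))\<^sup>2 = a + 2 * b + e" and n2: "(norm y)\<^sup>2 = e" and n3: "(norm z)\<^sup>2 = a"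
    and n4: "(norm ((\<tau> / (t + \<tau>)) *\<^sub>R z + y))\<^sup>2 = (\<tau> / (t + \<tau>))\<^sup>2 * a + 2 * (\<tau> / (t + \<tau>)) * b + e"
    unfolding power2_norm_eq_inner a_def b_def e_def
    by (simp_all add: inner_add_left inner_add_right inner_commute power2_eq_square)
  have q: "(a + 2 * b + e) / (4 * t) + e / (4 * \<tau>) = a / (4 * (t + \<tau>))
      + ((\<tau> / (t + \<tau>))\<^sup>2 * a + 2 * (\<tau> / (t + \<tau>)) * b + e) / (4 * (t * \<tau> / (t + \<tau>)))"
  proof -
    define r where "r = t + \<tau>"
    have r: "r > 0" "\<tau> = r - t" using assms by (auto simp: r_def)
    have "((\<tau> / r)\<^sup>2 * a + 2 * (\<tau> / r) * b + e) / (4 * (t * \<tau> / r))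
      = \<tau> * a / (4 * r * t) + b / (2 * t) + r * e / (4 * t * \<tau>)"
      using r(1) assms by (simp add: field_simps power2_eq_square)
    also have "\<tau> * a / (4 * r * t) = a / (4 * t) - a / (4 * r)"
      using r(1) assms by (simp add: r(2) field_simps)
    also have "r * e / (4 * t * \<tau>) = e / (4 * t) + e / (4 * \<tau>)"
      using assms by (simp add: r_def field_simps)
    finally show ?thesis
      unfolding r_def[symmetric] by (simp add: add_divide_distrib)
  qed
  have "exp (- (norm (z + y))\<^sup>2 / (4 * t)) * exp (- (norm y)\<^sup>2 / (4 * \<tau>))
    = exp (- (norm z)\<^sup>2 / (4 * (t + \<tau>)))
      * exp (- (norm ((\<tau> / (t + \<tau>)) *\<^sub>R z + y))\<^sup>2 / (4 * (t * \<tau> / (t + \<tau>))))"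
    unfolding mult_exp_exp n1 n2 n3 n4 by (simp only: minus_divide_left[symmetric] minus_add_distrib[symmetric] q)
  then show ?thesis
    unfolding heat_kernel_def p_def[symmetric] times_divide_times_eq c by simp
qed

lemma heat_kernel_convolution:
  fixes z :: "'a::euclidean_space"
  assumes "0 < t" "0 < \<tau>"
  shows "(\<integral>\<^sup>+y. ennreal (heat_kernel t (z + y) * heat_kernel \<tau> y) \<partial>lborel) = ennreal (heat_kernel (t + \<tau>) z)"
proof -
  have "(\<integral>\<^sup>+y. ennreal (heat_kernel t (z + y) * heat_kernel \<tau> y) \<partial>lborel)
    = ennreal (heat_kernel (t + \<tau>) z)
      * (\<integral>\<^sup>+y. ennreal (heat_kernel (t * \<tau> / (t + \<tau>)) ((\<tau> / (t + \<tau>)) *\<^sub>R z + y)) \<partial>lborel)"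
    unfolding heat_kernel_mult[OF assms] by (simp add: ennreal_mult' nn_integral_cmult)
  also have "(\<integral>\<^sup>+y. ennreal (heat_kernel (t * \<tau> / (t + \<tau>)) ((\<tau> / (t + \<tau>)) *\<^sub>R z + y)) \<partial>lborel) = 1"
    using assms by (subst nn_integral_shift) (simp_all add: nn_integral_heat_kernel)
  finally show ?thesis by simp
qed

lemma heat_kernel_semigroup:
  fixes h :: "'a::euclidean_space \<Rightarrow> ennreal"
  assumes "0 < t" "0 < \<tau>" and [measurable]: "h \<in> borel_measurable borel"
  shows "(\<integral>\<^sup>+x. ennreal (heat_kernel t x) * (\<integral>\<^sup>+y. ennreal (heat_kernel \<tau> y) * h (x - y) \<partial>lborel) \<partial>lborel)
    = (\<integral>\<^sup>+z. ennreal (heat_kernel (t + \<tau>) z) * h z \<partial>lborel)"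
proof -
  have "(\<integral>\<^sup>+x. ennreal (heat_kernel t x) * (\<integral>\<^sup>+y. ennreal (heat_kernel \<tau> y) * h (x - y) \<partial>lborel) \<partial>lborel)
    = (\<integral>\<^sup>+x. \<integral>\<^sup>+y. ennreal (heat_kernel t x * heat_kernel \<tau> y) * h (x - y) \<partial>lborel \<partial>lborel)"
    by (simp add: nn_integral_cmult[symmetric] ennreal_mult' mult.assoc)
  also have "\<dots> = (\<integral>\<^sup>+y. \<integral>\<^sup>+x. ennreal (heat_kernel t x * heat_kernel \<tau> y) * h (x - y) \<partial>lborel \<partial>lborel)"
    by (rule lborel_pair.Fubini') measurable
  also have "\<dots> = (\<integral>\<^sup>+y. \<integral>\<^sup>+z. ennreal (heat_kernel t (y + z) * heat_kernel \<tau> y) * h (y + z - y) \<partial>lborel \<partial>lborel)"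
  proof (rule nn_integral_cong)
    fix y :: 'a
    show "(\<integral>\<^sup>+x. ennreal (heat_kernel t x * heat_kernel \<tau> y) * h (x - y) \<partial>lborel)
      = (\<integral>\<^sup>+z. ennreal (heat_kernel t (y + z) * heat_kernel \<tau> y) * h (y + z - y) \<partial>lborel)"
      by (rule nn_integral_shift[where c=y, symmetric]) measurable
  qed
  also have "\<dots> = (\<integral>\<^sup>+y. \<integral>\<^sup>+z. ennreal (heat_kernel t (z + y) * heat_kernel \<tau> y) * h z \<partial>lborel \<partial>lborel)"
    by (simp add: add.commute)
  also have "\<dots> = (\<integral>\<^sup>+z. \<integral>\<^sup>+y. ennreal (heat_kernel t (z + y) * heat_kernel \<tau> y) * h z \<partial>lborel \<partial>lborel)"
    by (rule lborel_pair.Fubini') measurable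
  also have "\<dots> = (\<integral>\<^sup>+z. ennreal (heat_kernel (t + \<tau>) z) * h z \<partial>lborel)"
    by (simp add: nn_integral_multc heat_kernel_convolution[OF assms(1,2)])
  finally show ?thesis .
qed

text \<open>
  The bound \<open>r e\<^bsup>-2r\<^esup> \<le> e\<^bsup>-r\<^esup>\<close> with \<open>r = |z|\<^sup>2/8\<close> trades the factor \<open>|z|\<^sup>2\<close> for
  the kernel of the doubled time.
\<close>
lemma integrable_heat_kernel_second_moment:
  "integrable lborel (\<lambda>z::'a::euclidean_space. heat_kernel 1 z * (norm z)\<^sup>2)"
proof (rule Bochner_Integration.integrable_bound)
  define p where "p = real DIM('a) / 2"
  show "integrable lborel (\<lambda>z::'a. 8 * (8 * pi) powr p / (4 * pi) powr p * heat_kernel 2 z)"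
    using has_bochner_integral_heat_kernel[of 2, where 'a='a] by (intro integrable_mult_right) (auto simp: has_bochner_integral_iff)
  have "heat_kernel 1 z * (norm z)\<^sup>2 \<le> 8 * (8 * pi) powr p / (4 * pi) powr p * heat_kernel 2 z" for z :: 'a
  proof -
    define r where "r = (norm z)\<^sup>2 / 8"
    have "r * exp (- (2 * r)) \<le> exp r * exp (- (2 * r))"
      using exp_ge_add_one_self[of r] by (intro mult_right_mono) (linarith, simp)
    also have "\<dots> = exp (- r)" by (simp add: mult_exp_exp)
    finally have "8 * (r * exp (- (2 * r))) / (4 * pi) powr p \<le> 8 * exp (- r) / (4 * pi) powr p"
      by (intro divide_right_mono) auto
    then show ?thesis
      by (simp add: heat_kernel_def p_def[symmetric] r_def field_simps)
  qed
  then show "AE z::'a in lborel. norm (heat_kernel 1 z * (norm z)\<^sup>2)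
      \<le> norm (8 * (8 * pi) powr p / (4 * pi) powr p * heat_kernel 2 z)"
    by (intro AE_I2) (simp add: abs_mult)
qed measurable

lemma heat_kernel_scale:
  assumes "0 < \<tau>"
  shows "sqrt \<tau> ^ DIM('a) * heat_kernel \<tau> (sqrt \<tau> *\<^sub>R z) = heat_kernel 1 (z :: 'a::euclidean_space)"
proof -
  have "sqrt \<tau> ^ DIM('a) = \<tau> powr (real DIM('a) / 2)"
    using assms by (simp add: powr_realpow[symmetric] powr_half_sqrt[symmetric] powr_powr)
  moreover have "(norm (sqrt \<tau> *\<^sub>R z))\<^sup>2 / (4 * \<tau>) = (norm z)\<^sup>2 / 4"
    using assms by (simp add: power_mult_distrib)
  ultimately show ?thesis
    using assms by (simp add: heat_kernel_def powr_mult del: norm_scaleR)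
qed

text \<open>
  Parabolic scaling moves the dependence on \<open>\<tau>\<close> from the kernel, which is singular at
  \<open>\<tau> = 0\<close>, into the argument of the averaged function.
\<close>
lemma integral_heat_kernel_scale:
  fixes h :: "'a::euclidean_space \<Rightarrow> real"
  assumes "0 < \<tau>" and [measurable]: "h \<in> borel_measurable borel"
  shows "(LINT y|lborel. heat_kernel \<tau> y * h y) = (LINT z|lborel. heat_kernel 1 z * h (sqrt \<tau> *\<^sub>R z))"
proof -
  have "(LINT y|lborel. heat_kernel \<tau> y * h y)
    = (LINT z|lborel. (sqrt \<tau> ^ DIM('a)) * (heat_kernel \<tau> (sqrt \<tau> *\<^sub>R z) * h (sqrt \<tau> *\<^sub>R z)))"
    by (subst lborel_affine[of "sqrt \<tau>" 0])
      (use assms in \<open>simp_all add: integral_density integral_distr\<close>)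
  also have "\<dots> = (LINT z|lborel. heat_kernel 1 z * h (sqrt \<tau> *\<^sub>R z))"
    unfolding mult.assoc[symmetric] heat_kernel_scale[OF assms(1)] ..
  finally show ?thesis .
qed

lemma has_bochner_integral_heat_kernel_convolution:
  assumes "0 < t" "0 < \<tau>"
  shows "has_bochner_integral lborel (\<lambda>y. heat_kernel t (z - y) * heat_kernel \<tau> y) (heat_kernel (t + \<tau>) (z::'a::euclidean_space))"
proof (rule has_bochner_integral_nn_integral)
  have "(\<integral>\<^sup>+y. ennreal (heat_kernel t (z - y) * heat_kernel \<tau> y) \<partial>lborel)
    = (\<integral>\<^sup>+y. ennreal (heat_kernel t (z + y) * heat_kernel \<tau> y) \<partial>lborel)"
    using nn_integral_reflect[of "\<lambda>y. ennreal (heat_kernel t (z + y) * heat_kernel \<tau> y)" 0] by simp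
  then show "(\<integral>\<^sup>+y. ennreal (heat_kernel t (z - y) * heat_kernel \<tau> y) \<partial>lborel) = ennreal (heat_kernel (t + \<tau>) z)"
    by (simp add: heat_kernel_convolution[OF assms])
qed auto

lemma
  assumes "0 < \<tau>"
  shows integrable_heat_kernel: "integrable lborel (heat_kernel \<tau> :: 'a::euclidean_space \<Rightarrow> real)"
    and integral_heat_kernel: "(LINT z|lborel. heat_kernel \<tau> (z::'a::euclidean_space)) = 1"
  using has_bochner_integral_heat_kernel[OF assms, where 'a='a] by (auto simp: has_bochner_integral_iff)

lemma integrable_heat_kernel_moment:
  "integrable lborel (\<lambda>z::'a::euclidean_space. heat_kernel 1 z * (1 + norm z))"
proof (rule Bochner_Integration.integrable_bound)
  show "integrable lborel (\<lambda>z::'a. 2 * heat_kernel 1 z + heat_kernel 1 z * (norm z)\<^sup>2)"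
    by (intro Bochner_Integration.integrable_add integrable_mult_right integrable_heat_kernel integrable_heat_kernel_second_moment) simp
  have "heat_kernel 1 z * (1 + norm z) \<le> heat_kernel 1 z * (2 + (norm z)\<^sup>2)" for z :: 'a
  proof (rule mult_left_mono)
    have "0 \<le> (norm z - 1)\<^sup>2" by simp
    then show "1 + norm z \<le> 2 + (norm z)\<^sup>2"
      using norm_ge_zero[of z] by (simp add: power2_eq_square algebra_simps) (smt (verit) zero_le_square)
  qed simp
  then show "AE z::'a in lborel. norm (heat_kernel 1 z * (1 + norm z)) \<le> norm (2 * heat_kernel 1 z + heat_kernel 1 z * (norm z)\<^sup>2)"
    by (intro AE_I2) (simp add: algebra_simps abs_mult)
qed measurable

section \<open>Inversion of the Marchaud derivative on the half-line\<close>

text \<open>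
  For \<open>\<phi>(\<sigma>) = - \<integral>\<^bsub>r > \<sigma>\<^esub> \<psi>\<close>, Fubini's theorem and
  \<open>\<integral>\<^bsub>\<tau> > r\<^esub> \<tau>\<^bsup>-1-s\<^esup> d\<tau> = r\<^bsup>-s\<^esup>/s\<close> show that \<open>D \<sigma>\<close> is \<open>1/s\<close> times
  \<open>\<integral> (\<rho> - \<sigma>)\<^bsup>-s\<^esup> \<psi>(\<rho>) d\<rho>\<close> over \<open>\<rho> > \<sigma>\<close>.  Integrating against \<open>\<sigma>\<^bsup>s-1\<^esup>\<close> produces
  \<open>Beta s (1 - s) = \<Gamma>(s) \<Gamma>(1 - s)\<close>, independently of \<open>\<rho>\<close>, hence
  \<open>\<integral> \<sigma>\<^bsup>s-1\<^esup> D(\<sigma>) d\<sigma> = - \<Gamma>(s) \<Gamma>(1-s) \<phi>(0) / s = \<Gamma>(s) \<Gamma>(-s) \<phi>(0)\<close>.  The inequality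
  is this identity in absolute value.
\<close>
lemma marchaud_inversion:
  fixes \<phi> \<psi> :: "real \<Rightarrow> real"
  assumes s: "0 < s" "s < 1" and \<psi>: "integrable lborel \<psi>"
    and \<phi>: "\<And>\<sigma>. 0 \<le> \<sigma> \<Longrightarrow> \<phi> \<sigma> = - (LINT r|lborel. indicator {\<sigma><..} r * \<psi> r)"
  defines "D \<equiv> \<lambda>\<sigma>. LINT \<tau>|lborel. ppow (-1 - s) \<tau> * (\<phi> (\<sigma> + \<tau>) - \<phi> \<sigma>)"
  shows "ennreal (Gamma s * \<bar>\<phi> 0\<bar>) \<le> (\<integral>\<^sup>+\<sigma>. ennreal (ppow (s - 1) \<sigma> * \<bar>D \<sigma> / Gamma (- s)\<bar>) \<partial>lborel)"
proof -
  have [measurable]: "\<psi> \<in> borel_measurable borel"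
    using \<psi> by simp
  define B where "B = Beta s (1 - s)"
  have G1: "Gamma (1 - s) = - s * Gamma (- s)"
  proof -
    have "- s \<notin> \<int>\<^sub>\<le>\<^sub>0"
    proof
      assume "- s \<in> \<int>\<^sub>\<le>\<^sub>0"
      then obtain n where "- s = - of_nat n"
        by (elim nonpos_Ints_cases')
      with s show False by (cases n) auto
    qed
    from Gamma_plus1[OF this] show ?thesis by simp
  qed
  have G1pos: "Gamma (1 - s) > 0" using s by simp
  have Gneg: "Gamma (- s) < 0"
    using G1 G1pos s by (simp add: mult_less_0_iff)
  have B: "B = Gamma s * Gamma (1 - s)"
    by (simp add: B_def Beta_def)
  \<comment> \<open>Integrated over \<open>\<rho>\<close>, \<open>h\<close> gives \<open>s \<sigma>\<^bsup>s-1\<^esup> D(\<sigma>)\<close>; integrated over \<open>\<sigma>\<close>, it gives the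
    Beta integral times \<open>\<psi>(\<rho>)\<close>.\<close>
  define h where "h = (\<lambda>(\<sigma>, \<rho>). ppow (s - 1) \<sigma> * ppow (- s) (\<rho> - \<sigma>) * \<psi> \<rho>)"
  have h_meas [measurable]: "h \<in> borel_measurable (lborel \<Otimes>\<^sub>M lborel)"
    unfolding h_def by measurable
  have conv: "(\<integral>\<^sup>+\<sigma>. ennreal (ppow (s - 1) \<sigma> * ppow (- s) (\<rho> - \<sigma>)) \<partial>lborel) = ennreal (B * indicator {0<..} \<rho>)" for \<rho>
  proof (cases "0 < \<rho>")
    case True
    then show ?thesis
      using nn_integral_Beta[of s "1 - s" \<rho>] s by (simp add: B_def)
  next
    case False
    then have "ppow (s - 1) \<sigma> * ppow (- s) (\<rho> - \<sigma>) = 0" for \<sigma>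
      by (auto simp: ppow_def)
    then show ?thesis using False by (simp only:) simp
  qed
  have h_int: "integrable (lborel \<Otimes>\<^sub>M lborel) h"
  proof (rule integrableI_bounded)
    have "(\<integral>\<^sup>+p. ennreal (norm (h p)) \<partial>(lborel \<Otimes>\<^sub>M lborel))
      = (\<integral>\<^sup>+\<rho>. \<integral>\<^sup>+\<sigma>. ennreal (norm (h (\<sigma>, \<rho>))) \<partial>lborel \<partial>lborel)"
      by (rule lborel_pair.nn_integral_snd[symmetric]) measurable
    also have "\<dots> = (\<integral>\<^sup>+\<rho>. ennreal (B * indicator {0<..} \<rho>) * ennreal \<bar>\<psi> \<rho>\<bar> \<partial>lborel)"
      by (simp add: h_def abs_mult ennreal_mult'' nn_integral_multc flip: conv)
    also have "\<dots> \<le> (\<integral>\<^sup>+\<rho>. ennreal B * ennreal (norm (\<psi> \<rho>)) \<partial>lborel)"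
      by (intro nn_integral_mono mult_right_mono ennreal_leI) (auto simp: B s split: split_indicator)
    also have "\<dots> = ennreal B * (\<integral>\<^sup>+\<rho>. ennreal (norm (\<psi> \<rho>)) \<partial>lborel)"
      by (simp add: nn_integral_cmult)
    also have "\<dots> < \<infinity>"
      using \<psi> unfolding integrable_iff_bounded by (simp add: ennreal_mult_less_top)
    finally show "(\<integral>\<^sup>+p. ennreal (norm (h p)) \<partial>(lborel \<Otimes>\<^sub>M lborel)) < \<infinity>" .
  qed measurable
  have D_eq: "D \<sigma> = (1 / s) * (LINT \<rho>|lborel. ppow (- s) (\<rho> - \<sigma>) * \<psi> \<rho>)"
    if \<sigma>: "0 < \<sigma>" and int: "integrable lborel (\<lambda>\<rho>. ppow (- s) (\<rho> - \<sigma>) * \<psi> \<rho>)" for \<sigma>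
  proof -
    define k where "k = (\<lambda>(\<tau>, \<rho>). ppow (-1 - s) \<tau> * (indicator {\<sigma><..} \<rho> * indicator {\<rho> - \<sigma>..} \<tau>) * \<psi> \<rho>)"
    have [measurable]: "k \<in> borel_measurable (lborel \<Otimes>\<^sub>M lborel)"
      unfolding k_def indicator_def greaterThan_iff atLeast_iff by measurable
    have tail: "(\<integral>\<^sup>+\<tau>. ennreal (ppow (-1 - s) \<tau> * (indicator {\<sigma><..} \<rho> * indicator {\<rho> - \<sigma>..} \<tau>)) \<partial>lborel)
      = ennreal (ppow (- s) (\<rho> - \<sigma>) / s)" for \<rho>
    proof (cases "\<sigma> < \<rho>")
      case True
      have "(\<integral>\<^sup>+\<tau>. ennreal (ppow (-1 - s) \<tau> * (indicator {\<sigma><..} \<rho> * indicator {\<rho> - \<sigma>..} \<tau>)) \<partial>lborel)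
        = (\<integral>\<^sup>+\<tau>. ennreal (ppow (-1 - s) \<tau>) * indicator {\<rho> - \<sigma>..} \<tau> \<partial>lborel)"
        using True by (intro nn_integral_cong) (auto split: split_indicator)
      then show ?thesis
        using True nn_integral_ppow_tail[OF s(1), of "\<rho> - \<sigma>"] by (simp add: ppow_pos)
    qed (simp add: ppow_nonpos)
    have k_int: "integrable (lborel \<Otimes>\<^sub>M lborel) k"
    proof (rule integrableI_bounded)
      have "(\<integral>\<^sup>+p. ennreal (norm (k p)) \<partial>(lborel \<Otimes>\<^sub>M lborel))
        = (\<integral>\<^sup>+\<rho>. \<integral>\<^sup>+\<tau>. ennreal (norm (k (\<tau>, \<rho>))) \<partial>lborel \<partial>lborel)"
        by (rule lborel_pair.nn_integral_snd[symmetric]) measurable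
      also have "\<dots> = (\<integral>\<^sup>+\<rho>. (\<integral>\<^sup>+\<tau>. ennreal (ppow (-1 - s) \<tau> * (indicator {\<sigma><..} \<rho> * indicator {\<rho> - \<sigma>..} \<tau>)) \<partial>lborel) * ennreal \<bar>\<psi> \<rho>\<bar> \<partial>lborel)"
        by (simp add: k_def abs_mult ennreal_mult'' nn_integral_multc)
      also have "\<dots> = (\<integral>\<^sup>+\<rho>. ennreal (1 / s) * ennreal (norm (ppow (- s) (\<rho> - \<sigma>) * \<psi> \<rho>)) \<partial>lborel)"
        unfolding tail using s by (simp add: ennreal_mult''[symmetric] ennreal_mult'[symmetric] abs_mult)
      also have "\<dots> = ennreal (1 / s) * (\<integral>\<^sup>+\<rho>. ennreal (norm (ppow (- s) (\<rho> - \<sigma>) * \<psi> \<rho>)) \<partial>lborel)"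
        by (rule nn_integral_cmult) measurable
      also have "\<dots> < \<infinity>"
        using int unfolding integrable_iff_bounded by (simp add: ennreal_mult_less_top)
      finally show "(\<integral>\<^sup>+p. ennreal (norm (k p)) \<partial>(lborel \<Otimes>\<^sub>M lborel)) < \<infinity>" .
    qed measurable
    have diff: "ppow (-1 - s) \<tau> * (\<phi> (\<sigma> + \<tau>) - \<phi> \<sigma>) = (LINT \<rho>|lborel. k (\<tau>, \<rho>))" for \<tau>
    proof (cases "0 < \<tau>")
      case True
      have i: "integrable lborel (\<lambda>\<rho>. indicator {c<..} \<rho> * \<psi> \<rho>)" for c :: real
        using integrable_mult_indicator[OF _ \<psi>, of "{c<..}"] by simp
      have "\<phi> (\<sigma> + \<tau>) - \<phi> \<sigma> = (LINT \<rho>|lborel. indicator {\<sigma><..} \<rho> * \<psi> \<rho> - indicator {\<sigma> + \<tau><..} \<rho> * \<psi> \<rho>)"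
        using \<sigma> True by (simp add: \<phi> i)
      also have "\<dots> = (LINT \<rho>|lborel. (indicator {\<sigma><..} \<rho> * indicator {\<rho> - \<sigma>..} \<tau>) * \<psi> \<rho>)"
        using True by (intro Bochner_Integration.integral_cong) (auto split: split_indicator)
      finally show ?thesis
        by (simp add: k_def mult.assoc)
    qed (simp add: ppow_def k_def)
    have "D \<sigma> = (LINT \<tau>|lborel. LINT \<rho>|lborel. k (\<tau>, \<rho>))"
      unfolding D_def diff ..
    also have "\<dots> = (LINT \<rho>|lborel. LINT \<tau>|lborel. k (\<tau>, \<rho>))"
      using lborel_pair.Fubini_integral[of "\<lambda>\<tau> \<rho>. k (\<tau>, \<rho>)"] k_int by simp
    also have "\<dots> = (LINT \<rho>|lborel. (1 / s) * (ppow (- s) (\<rho> - \<sigma>) * \<psi> \<rho>))"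
    proof (intro Bochner_Integration.integral_cong refl)
      fix \<rho> :: real
      have "has_bochner_integral lborel (\<lambda>\<tau>. ppow (-1 - s) \<tau> * (indicator {\<sigma><..} \<rho> * indicator {\<rho> - \<sigma>..} \<tau>)) (ppow (- s) (\<rho> - \<sigma>) / s)"
        using tail[of \<rho>] s by (intro has_bochner_integral_nn_integral) auto
      then show "(LINT \<tau>|lborel. k (\<tau>, \<rho>)) = (1 / s) * (ppow (- s) (\<rho> - \<sigma>) * \<psi> \<rho>)"
        by (simp add: k_def has_bochner_integral_iff)
    qed
    finally show ?thesis by simp
  qed
  \<comment> \<open>\<open>D_eq\<close> needs \<open>\<psi>\<close> to be integrable against the singular weight at \<open>\<sigma>\<close>, which Fubini's
    theorem provides for almost every \<open>\<sigma>\<close> only.\<close>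
  have AE1: "AE \<sigma> in lborel. integrable lborel (\<lambda>\<rho>. h (\<sigma>, \<rho>))"
    using lborel_pair.AE_integrable_fst[of "\<lambda>\<sigma> \<rho>. h (\<sigma>, \<rho>)"] h_int by simp
  have AE2: "AE \<sigma> in lborel. ppow (s - 1) \<sigma> * \<bar>D \<sigma> / Gamma (- s)\<bar>
      = \<bar>LINT \<rho>|lborel. h (\<sigma>, \<rho>)\<bar> / Gamma (1 - s)"
    using AE1
  proof eventually_elim
    case (elim \<sigma>)
    show ?case
    proof (cases "0 < \<sigma>")
      case True
      then have "integrable lborel (\<lambda>\<rho>. ppow (- s) (\<rho> - \<sigma>) * \<psi> \<rho>)"
        using elim by (simp add: h_def mult.assoc ppow_pos)
      from D_eq[OF True this] show ?thesis
        using s G1pos by (simp add: h_def mult.assoc abs_mult abs_divide G1 abs_of_neg[OF Gneg]) 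
    qed (simp add: ppow_nonpos h_def)
  qed
  have "(LINT \<sigma>|lborel. LINT \<rho>|lborel. h (\<sigma>, \<rho>)) = (LINT \<rho>|lborel. LINT \<sigma>|lborel. h (\<sigma>, \<rho>))"
    using lborel_pair.Fubini_integral[of "\<lambda>\<sigma> \<rho>. h (\<sigma>, \<rho>)"] h_int by simp
  also have "\<dots> = (LINT \<rho>|lborel. B * (indicator {0<..} \<rho> * \<psi> \<rho>))"
  proof (intro Bochner_Integration.integral_cong refl)
    fix \<rho> :: real
    have "has_bochner_integral lborel (\<lambda>\<sigma>. ppow (s - 1) \<sigma> * ppow (- s) (\<rho> - \<sigma>)) (B * indicator {0<..} \<rho>)"
      using conv[of \<rho>] s by (intro has_bochner_integral_nn_integral) (auto simp: B)
    then show "(LINT \<sigma>|lborel. h (\<sigma>, \<rho>)) = B * (indicator {0<..} \<rho> * \<psi> \<rho>)"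
      by (simp add: h_def has_bochner_integral_iff)
  qed
  also have "\<dots> = - B * \<phi> 0"
    by (simp add: \<phi>)
  finally have total: "(LINT \<sigma>|lborel. LINT \<rho>|lborel. h (\<sigma>, \<rho>)) = - B * \<phi> 0" .
  have "Gamma s * \<bar>\<phi> 0\<bar> = \<bar>LINT \<sigma>|lborel. LINT \<rho>|lborel. h (\<sigma>, \<rho>)\<bar> / Gamma (1 - s)"
  proof -
    have "Gamma (1 - s) \<noteq> 0" using G1pos by linarith
    then show ?thesis
      unfolding total B using s by (simp add: abs_mult)
  qed
  also have "ennreal \<dots> = ennreal (norm (LINT \<sigma>|lborel. LINT \<rho>|lborel. h (\<sigma>, \<rho>))) * ennreal (1 / Gamma (1 - s))"
    using G1pos by (simp add: ennreal_mult'[symmetric])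
  also have "\<dots> \<le> (\<integral>\<^sup>+\<sigma>. ennreal (norm (LINT \<rho>|lborel. h (\<sigma>, \<rho>))) \<partial>lborel) * ennreal (1 / Gamma (1 - s))"
    using lborel_pair.integrable_fst'[OF h_int]
    by (intro mult_right_mono integral_norm_bound_ennreal) simp_all
  also have "\<dots> = (\<integral>\<^sup>+\<sigma>. ennreal (\<bar>LINT \<rho>|lborel. h (\<sigma>, \<rho>)\<bar> / Gamma (1 - s)) \<partial>lborel)"
    using G1pos by (subst nn_integral_multc[symmetric]) (auto simp: ennreal_mult'[symmetric])
  also have "\<dots> = (\<integral>\<^sup>+\<sigma>. ennreal (ppow (s - 1) \<sigma> * \<bar>D \<sigma> / Gamma (- s)\<bar>) \<partial>lborel)"
    using AE2 by (intro nn_integral_cong_AE) auto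
  finally show ?thesis .
qed

section \<open>Schwartz functions as decaying functions with Lipschitz gradient\<close>

text \<open>
  What the argument uses of a Schwartz function: the gradient is continuous and Lipschitz, and the
  function and its gradient decay like \<open>1/(1 + t\<^sup>2)\<close> in the last variable, uniformly in \<open>x\<close>.
\<close>
locale decaying_C2 =
  fixes U :: "'a::euclidean_space \<times> real \<Rightarrow> real"
    and DU :: "'a \<times> real \<Rightarrow> 'a \<times> real \<Rightarrow> real"
    and K :: real
  assumes deriv: "(U has_derivative DU p) (at p)"
    and DU_cont: "continuous_on UNIV (\<lambda>p. DU p h)"
    and U_bound: "\<bar>U p\<bar> \<le> K / (1 + (snd p)\<^sup>2)"
    and DU_bound: "\<bar>DU p h\<bar> \<le> K * norm h / (1 + (snd p)\<^sup>2)"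
    and DU_lipschitz: "\<bar>DU p h - DU q h\<bar> \<le> K * norm (p - q) * norm h"

lemma frechet_derivative_bound_Basis:
  fixes f :: "'a::euclidean_space \<Rightarrow> real"
  assumes "f differentiable (at x)"
    and "\<And>b. b \<in> Basis \<Longrightarrow> \<bar>frechet_derivative f (at x) b\<bar> \<le> C b"
  shows "\<bar>frechet_derivative f (at x) h\<bar> \<le> (\<Sum>b\<in>Basis. C b) * norm h"
proof -
  interpret bounded_linear "frechet_derivative f (at x)"
    using assms(1) unfolding frechet_derivative_works by (rule has_derivative_bounded_linear)
  have "frechet_derivative f (at x) h = frechet_derivative f (at x) (\<Sum>b\<in>Basis. (h \<bullet> b) *\<^sub>R b)"
    by (simp add: euclidean_representation)
  also have "\<dots> = (\<Sum>b\<in>Basis. (h \<bullet> b) * frechet_derivative f (at x) b)"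
    by (simp add: sum scaleR)
  also have "\<bar>\<dots>\<bar> \<le> (\<Sum>b\<in>Basis. \<bar>(h \<bullet> b) * frechet_derivative f (at x) b\<bar>)"
    by (rule sum_abs)
  also have "\<dots> \<le> (\<Sum>b\<in>Basis. norm h * C b)"
    using assms(2) by (intro sum_mono) (auto simp: abs_mult intro!: mult_mono Basis_le_norm)
  finally show ?thesis by (simp add: sum_distrib_left mult.commute)
qed

text \<open>
  Boundedness and quadratic decay of each partial derivative add up to the decay
  \<open>1/(1 + |p|\<^sup>2)\<close>, and \<open>|t| \<le> |p|\<close>; bounded second partial derivatives make the first ones
  Lipschitz by the mean value theorem.
\<close>
lemma schwartz_decaying_C2:
  fixes U :: "'a::euclidean_space \<times> real \<Rightarrow> real"
  assumes "U \<in> schwartz_space"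
  shows "\<exists>K. decaying_C2 U (\<lambda>p. frechet_derivative U (at p)) K"
proof -
  let ?B = "Basis :: ('a \<times> real) set"
  have diff: "partials bs U differentiable (at p)" if "bs \<in> lists ?B" for bs p
    using assms that unfolding schwartz_space_def smooth_def differentiable_on_def by blast
  have "\<exists>C. \<forall>p. \<bar>partials bs U p\<bar> \<le> C / (1 + (snd p)\<^sup>2)" if bs: "bs \<in> lists ?B" for bs
  proof -
    obtain C0 where C0: "norm p ^ 0 * \<bar>partials bs U p\<bar> \<le> C0" for p
      using assms bs unfolding schwartz_space_def by blast
    obtain C2 where C2: "norm p ^ 2 * \<bar>partials bs U p\<bar> \<le> C2" for p
      using assms bs unfolding schwartz_space_def by blast
    have "\<bar>partials bs U p\<bar> \<le> (C0 + C2) / (1 + (snd p)\<^sup>2)" for p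
    proof -
      have "(snd p)\<^sup>2 \<le> (norm p)\<^sup>2"
        by (cases p) (simp add: norm_Pair)
      then have "(snd p)\<^sup>2 * \<bar>partials bs U p\<bar> \<le> (norm p)\<^sup>2 * \<bar>partials bs U p\<bar>"
        by (intro mult_right_mono) auto
      with C0[of p] C2[of p] have "(1 + (snd p)\<^sup>2) * \<bar>partials bs U p\<bar> \<le> C0 + C2"
        by (simp add: algebra_simps)
      moreover have "1 + (snd p)\<^sup>2 > 0" by (intro add_pos_nonneg) auto
      ultimately show ?thesis by (simp add: pos_le_divide_eq mult.commute)
    qed
    then show ?thesis by blast
  qed
  then obtain C where C: "\<bar>partials bs U p\<bar> \<le> C bs / (1 + (snd p)\<^sup>2)" if "bs \<in> lists ?B" for bs p
    by metis
  have pos: "1 + (snd p)\<^sup>2 \<ge> 1" for p :: "'a \<times> real" by simp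
  have C_nonneg: "0 \<le> C bs" if "bs \<in> lists ?B" for bs
    using C[OF that, of 0] by (smt (verit) abs_ge_zero div_by_1 power_zero_numeral snd_zero)
  have C_bound: "\<bar>partials bs U p\<bar> \<le> C bs" if "bs \<in> lists ?B" for bs p
  proof -
    have "C bs / (1 + (snd p)\<^sup>2) \<le> C bs / 1"
      using C_nonneg[OF that] by (intro divide_left_mono) (auto intro: add_pos_nonneg)
    then show ?thesis using C[OF that, of p] by simp
  qed
  define P where "P = (\<lambda>b p. frechet_derivative U (at p) b)"
  have P: "P b = partials [b] U" for b by (simp add: P_def)
  define L where "L b = (\<Sum>c\<in>?B. C [c, b])" for b
  have L_nonneg: "0 \<le> L b" if "b \<in> ?B" for b
    using that by (auto simp: L_def intro!: sum_nonneg C_nonneg)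
  have P_lip: "\<bar>P b p - P b q\<bar> \<le> L b * norm (p - q)" if b: "b \<in> ?B" for b p q
  proof -
    have "norm (P b p - P b q) \<le> L b * norm (p - q)"
    proof (rule differentiable_bound[of UNIV])
      fix x :: "'a \<times> real"
      have "P b differentiable (at x)" unfolding P using b by (intro diff) auto
      then show "(P b has_derivative frechet_derivative (P b) (at x)) (at x within UNIV)"
        by (simp add: frechet_derivative_works[symmetric])
      have "\<bar>frechet_derivative (P b) (at x) h\<bar> \<le> L b * norm h" for h
        unfolding L_def
      proof (rule frechet_derivative_bound_Basis)
        show "P b differentiable (at x)" by fact
        fix c assume "c \<in> ?B"
        then show "\<bar>frechet_derivative (P b) (at x) c\<bar> \<le> C [c, b]"
          using C_bound[of "[c, b]" x] b by (simp add: P)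
      qed
      then show "onorm (frechet_derivative (P b) (at x)) \<le> L b"
        by (intro onorm_bound L_nonneg b) auto
    qed auto
    then show ?thesis by simp
  qed
  define K1 K2 where "K1 = (\<Sum>b\<in>?B. C [b])" and "K2 = (\<Sum>b\<in>?B. L b)"
  have K1: "0 \<le> K1" unfolding K1_def by (intro sum_nonneg C_nonneg) auto
  have K2: "0 \<le> K2" unfolding K2_def by (intro sum_nonneg L_nonneg)
  have C0: "0 \<le> C []" by (rule C_nonneg) auto
  define K where "K = C [] + K1 + K2"
  have U_diff: "U differentiable (at p)" for p using diff[of "[]"] by simp
  have rep: "frechet_derivative U (at p) h = (\<Sum>b\<in>?B. (h \<bullet> b) * P b p)" for p h
  proof -
    interpret bounded_linear "frechet_derivative U (at p)"
      using U_diff[of p] unfolding frechet_derivative_works by (rule has_derivative_bounded_linear)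
    have "frechet_derivative U (at p) h = frechet_derivative U (at p) (\<Sum>b\<in>?B. (h \<bullet> b) *\<^sub>R b)"
      by (simp only: euclidean_representation)
    also have "\<dots> = (\<Sum>b\<in>?B. (h \<bullet> b) * P b p)"
      by (simp add: sum scaleR P_def)
    finally show ?thesis .
  qed
  have "decaying_C2 U (\<lambda>p. frechet_derivative U (at p)) K"
  proof
    show "(U has_derivative frechet_derivative U (at p)) (at p)" for p
      using U_diff by (simp add: frechet_derivative_works[symmetric])
    show "continuous_on UNIV (\<lambda>p. frechet_derivative U (at p) h)" for h
    proof -
      have "continuous_on UNIV (P b)" if "b \<in> ?B" for b
        using that diff[of "[b]"] unfolding P
        by (intro differentiable_imp_continuous_on) (simp add: differentiable_on_def)
      then show ?thesis unfolding rep by (intro continuous_intros) auto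
    qed
    show "\<bar>U p\<bar> \<le> K / (1 + (snd p)\<^sup>2)" for p
    proof -
      have "C [] / (1 + (snd p)\<^sup>2) \<le> K / (1 + (snd p)\<^sup>2)"
        using K1 K2 pos[of p] by (intro divide_right_mono) (auto simp: K_def)
      then show ?thesis using C[of "[]" p] by simp
    qed
    show "\<bar>frechet_derivative U (at p) h\<bar> \<le> K * norm h / (1 + (snd p)\<^sup>2)" for p h
    proof -
      have "\<bar>frechet_derivative U (at p) h\<bar> \<le> (\<Sum>b\<in>?B. C [b] / (1 + (snd p)\<^sup>2)) * norm h"
        using C[of "[_]" p] by (intro frechet_derivative_bound_Basis U_diff) simp
      also have "\<dots> = K1 * norm h / (1 + (snd p)\<^sup>2)"
        by (simp add: K1_def sum_divide_distrib[symmetric])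
      also have "\<dots> \<le> K * norm h / (1 + (snd p)\<^sup>2)"
        using C0 K2 by (intro divide_right_mono mult_right_mono) (auto simp: K_def)
      finally show ?thesis .
    qed
    show "\<bar>frechet_derivative U (at p) h - frechet_derivative U (at q) h\<bar> \<le> K * norm (p - q) * norm h" for p q h
    proof -
      have "\<bar>frechet_derivative U (at p) h - frechet_derivative U (at q) h\<bar> = \<bar>\<Sum>b\<in>?B. (h \<bullet> b) * (P b p - P b q)\<bar>"
        unfolding rep by (simp add: sum_subtractf algebra_simps)
      also have "\<dots> \<le> (\<Sum>b\<in>?B. \<bar>(h \<bullet> b) * (P b p - P b q)\<bar>)"
        by (rule sum_abs)
      also have "\<dots> \<le> (\<Sum>b\<in>?B. norm h * (L b * norm (p - q)))"
      proof (rule sum_mono)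
        fix b assume b: "b \<in> ?B"
        show "\<bar>(h \<bullet> b) * (P b p - P b q)\<bar> \<le> norm h * (L b * norm (p - q))"
          unfolding abs_mult using Basis_le_norm[OF b] P_lip[OF b] by (intro mult_mono) auto
      qed
      also have "\<dots> = K2 * norm (p - q) * norm h"
        by (simp add: K2_def sum_distrib_left sum_distrib_right mult_ac)
      also have "\<dots> \<le> K * norm (p - q) * norm h"
        using C0 K1 by (intro mult_right_mono) (auto simp: K_def)
      finally show ?thesis .
    qed
  qed
  then show ?thesis by blast
qed

context decaying_C2
begin

lemma DU_linear: "bounded_linear (DU p)"
  using deriv by (rule has_derivative_bounded_linear)

lemma K_nonneg: "0 \<le> K"
  using U_bound[of 0] by simp

lemma U_bounded: "\<bar>U p\<bar> \<le> K"
proof -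
  have "K / (1 + (snd p)\<^sup>2) \<le> K / 1"
    using K_nonneg by (intro divide_left_mono) (auto intro: add_pos_nonneg)
  then show ?thesis using U_bound[of p] by simp
qed

lemma U_continuous: "continuous_on UNIV U"
  by (intro continuous_at_imp_continuous_on ballI has_derivative_continuous[OF deriv])

lemma U_measurable [measurable (raw)]:
  assumes [measurable]: "f \<in> borel_measurable M" "g \<in> borel_measurable M"
  shows "(\<lambda>w. U (f w, g w)) \<in> borel_measurable M"
  by (rule borel_measurable_continuous_on[OF U_continuous borel_measurable_Pair]) measurable

text \<open>
  Linearity in the direction reduces the joint measurability of the derivative to finitely many
  functions of the base point alone, which are continuous.
\<close>
lemma DU_measurable:
  assumes [measurable]: "f \<in> borel_measurable M" "g \<in> borel_measurable M" "h \<in> borel_measurable M"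
  shows "(\<lambda>w. DU (f w, g w) (h w)) \<in> borel_measurable M"
proof -
  have "DU (f w, g w) (h w) = (\<Sum>b\<in>Basis. (h w \<bullet> b) * DU (f w, g w) b)" for w
  proof -
    interpret bounded_linear "DU (f w, g w)" by (rule DU_linear)
    have "DU (f w, g w) (h w) = DU (f w, g w) (\<Sum>b\<in>Basis. (h w \<bullet> b) *\<^sub>R b)"
      by (simp only: euclidean_representation)
    then show ?thesis by (simp add: sum scaleR)
  qed
  moreover have [measurable]: "(\<lambda>w. DU (f w, g w) b) \<in> borel_measurable M" for b
    by (rule borel_measurable_continuous_on[OF DU_cont borel_measurable_Pair]) measurable
  ultimately show ?thesis by simp
qed

lemma Taylor: "\<bar>U (p + h) - U p - DU p h\<bar> \<le> K * (norm h)\<^sup>2"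
proof -
  have "norm (U (p + h) - U p - DU p (p + h - p)) \<le> norm (p + h - p) * (K * norm h)"
  proof (rule differentiable_bound_linearization[where S="cball p (norm h)"])
    fix t :: real assume "t \<in> {0..1}" 
    show "p + t *\<^sub>R (p + h - p) \<in> cball p (norm h)"
      using \<open>t \<in> {0..1}\<close> by (simp add: dist_norm mult_left_le_one_le)
  next
    show "onorm (DU x - DU p) \<le> K * norm h" if "x \<in> cball p (norm h)" for x
    proof (rule onorm_bound)
      fix v
      have "\<bar>DU x v - DU p v\<bar> \<le> K * norm (x - p) * norm v" by (rule DU_lipschitz)
      also have "\<dots> \<le> K * norm h * norm v"
        using that K_nonneg by (intro mult_right_mono mult_left_mono) (auto simp: dist_norm norm_minus_commute)
      finally show "norm ((DU x - DU p) v) \<le> K * norm h * norm v" by simp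
    qed (simp add: K_nonneg)
  next
    show "(U has_derivative DU x) (at x within cball p (norm h))" for x
      using deriv by (rule has_derivative_at_withinI)
  qed simp
  then show ?thesis by (simp add: power2_eq_square mult_ac)
qed

end

section \<open>The heat extension along a half-line\<close>

text \<open>
  The average of a function along these curves over \<open>z\<close> with density \<open>G\<^sub>1(z)\<close> is
  \<open>V(x,t,r)\<close>: the scaling by \<open>\<surd>r\<close> transfers the dependence on \<open>r\<close> from the kernel to the
  function.
\<close>
definition curve :: "'a::real_normed_vector \<Rightarrow> real \<Rightarrow> 'a \<Rightarrow> real \<Rightarrow> 'a \<times> real" where
  "curve x t z r = (x - sqrt r *\<^sub>R z, t + r)"

context decaying_C2
begin

definition curve_deriv :: "'a \<Rightarrow> real \<Rightarrow> 'a \<Rightarrow> real \<Rightarrow> real" where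
  "curve_deriv x t z r = DU (curve x t z r) (0, 1) - DU (curve x t z r) (z, 0) / (2 * sqrt r)"

lemma curve_deriv_measurable [measurable (raw)]:
  assumes [measurable]: "f \<in> borel_measurable M" "g \<in> borel_measurable M"
  shows "(\<lambda>w. curve_deriv x t (f w) (g w)) \<in> borel_measurable M"
proof -
  note [measurable (raw)] = DU_measurable
  have [measurable]: "(\<lambda>w. (f w, 0 :: real)) \<in> borel_measurable M"
    by (rule borel_measurable_Pair) measurable
  show ?thesis
    unfolding curve_deriv_def curve_def by measurable
qed

lemma has_curve_deriv:
  assumes "0 < r"
  shows "((\<lambda>r. U (curve x t z r)) has_real_derivative curve_deriv x t z r) (at r)"
proof -
  let ?v = "(- (1 / (2 * sqrt r)) *\<^sub>R z, 1 :: real)"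
  have "((\<lambda>r. curve x t z r) has_vector_derivative ?v) (at r)"
    unfolding curve_def
  proof (rule has_vector_derivative_Pair)
    have "((\<lambda>r. sqrt r) has_real_derivative 1 / (2 * sqrt r)) (at r)"
      using assms by (auto intro!: derivative_eq_intros simp: field_simps)
    from has_vector_derivative_scaleR[OF this has_vector_derivative_const[of z]]
    have "((\<lambda>r. sqrt r *\<^sub>R z) has_vector_derivative (1 / (2 * sqrt r)) *\<^sub>R z) (at r)"
      by simp
    from has_vector_derivative_diff[OF has_vector_derivative_const[of x] this]
    show "((\<lambda>r. x - sqrt r *\<^sub>R z) has_vector_derivative - (1 / (2 * sqrt r)) *\<^sub>R z) (at r)"
      by simp
    show "((\<lambda>r. t + r) has_vector_derivative 1) (at r)"
      by (auto intro!: derivative_eq_intros)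
  qed
  then have "((\<lambda>r. U (curve x t z r)) has_derivative (\<lambda>h. DU (curve x t z r) (h *\<^sub>R ?v))) (at r)"
    unfolding has_vector_derivative_def by (rule has_derivative_compose[OF _ deriv])
  moreover have "DU (curve x t z r) (h *\<^sub>R ?v) = curve_deriv x t z r * h" for h
  proof -
    interpret bounded_linear "DU (curve x t z r)" by (rule DU_linear)
    have "?v = (0, 1) - (1 / (2 * sqrt r)) *\<^sub>R (z, 0)" by simp
    then have "DU (curve x t z r) ?v = curve_deriv x t z r"
      unfolding curve_deriv_def by (simp only: diff scaleR) simp
    then show ?thesis by (simp only: scaleR) simp
  qed
  ultimately show ?thesis by (simp only: has_field_derivative_def)
qed

text \<open>
  The factor \<open>1/\<surd>r\<close> comes from differentiating \<open>\<surd>r\<close>; the decay at infinity is that of the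
  gradient.  The majorant is a product of a function of \<open>z\<close> with a finite Gaussian moment and
  an integrable function of \<open>r\<close>.
\<close>
lemma curve_deriv_bound:
  assumes "0 \<le> t" "0 < r"
  shows "\<bar>curve_deriv x t z r\<bar> \<le> 4 * K * (1 + norm z) * (ppow (1/2 - 1) r * (1 + r) powr (- 1))"
proof -
  define q where "q = sqrt r"
  have q: "0 < q" "r = q\<^sup>2" using assms by (auto simp: q_def)
  have pos: "0 < 1 + (t + r)\<^sup>2" by (intro add_pos_nonneg) auto
  have pos4: "0 < 1 + q ^ 4" by (intro add_pos_nonneg) auto
  have "\<bar>curve_deriv x t z r\<bar> \<le> \<bar>DU (curve x t z r) (0, 1)\<bar> + \<bar>DU (curve x t z r) (z, 0)\<bar> / (2 * sqrt r)"
    unfolding curve_deriv_def using assms by (intro order.trans[OF abs_triangle_ineq4]) (simp add: abs_divide)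
  also have "\<dots> \<le> K / (1 + (t + r)\<^sup>2) + (K * norm z / (1 + (t + r)\<^sup>2)) / (2 * sqrt r)"
    using DU_bound[of "curve x t z r" "(0, 1)"] DU_bound[of "curve x t z r" "(z, 0)"] assms
    by (intro add_mono divide_right_mono) (auto simp: curve_def norm_Pair)
  also have "\<dots> = K * (1 + norm z / (2 * q)) / (1 + (t + r)\<^sup>2)"
    by (simp add: q_def[symmetric] add_divide_distrib distrib_left mult_ac)
  also have "\<dots> \<le> K * ((1 + norm z) * (1 + 1 / q)) / (1 + r\<^sup>2)"
  proof (rule frac_le)
    have "norm z / (2 * q) \<le> norm z / q"
      using q by (intro divide_left_mono) auto
    moreover have "(1 + norm z) * (1 + 1 / q) = 1 + norm z + 1 / q + norm z / q"
      by (simp add: algebra_simps)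
    moreover have "0 \<le> 1 / q" using q by simp
    ultimately have "1 + norm z / (2 * q) \<le> (1 + norm z) * (1 + 1 / q)"
      using norm_ge_zero[of z] by linarith
    then show "K * (1 + norm z / (2 * q)) \<le> K * ((1 + norm z) * (1 + 1 / q))"
      using K_nonneg by (rule mult_left_mono)
    show "1 + r\<^sup>2 \<le> 1 + (t + r)\<^sup>2"
      using assms by (simp add: power_mono)
    show "0 < 1 + r\<^sup>2" by (intro add_pos_nonneg) auto
    show "0 \<le> K * ((1 + norm z) * (1 + 1 / q))" using q K_nonneg by simp
  qed
  also have "\<dots> = K * (1 + norm z) * ((1 + 1 / q) / (1 + q ^ 4))"
    using q by (simp add: power_mult[symmetric])
  also have "\<dots> \<le> K * (1 + norm z) * (4 * (1 / (q * (1 + q\<^sup>2))))"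
  proof (rule mult_left_mono)
    have "(1 + q) * (1 + q\<^sup>2) \<le> 4 * (1 + q ^ 4)"
    proof -
      \<comment> \<open>The mixed powers are absorbed by \<open>2q \<le> 1 + q\<^sup>2\<close>, \<open>2q\<^sup>3 \<le> q\<^sup>2 + q\<^sup>4\<close> and
        \<open>2q\<^sup>2 \<le> 1 + q\<^sup>4\<close>.\<close>
      have "0 \<le> (1 - q)\<^sup>2" "0 \<le> (q - q\<^sup>2)\<^sup>2" "0 \<le> (1 - q\<^sup>2)\<^sup>2" "0 \<le> q ^ 4" by simp_all
      then show ?thesis by (simp add: power2_eq_square algebra_simps power4_eq_xxxx)
    qed
    moreover have "0 < 1 + q\<^sup>2" by (intro add_pos_nonneg) auto
    ultimately show "(1 + 1 / q) / (1 + q ^ 4) \<le> 4 * (1 / (q * (1 + q\<^sup>2)))"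
      using q pos4 by (simp add: divide_simps) (simp add: algebra_simps)
  qed (use K_nonneg in auto)
  also have "1 / (q * (1 + q\<^sup>2)) = ppow (1/2 - 1) r * (1 + r) powr (- 1)"
  proof -
    have "r powr (- (1/2)) = 1 / q"
      using assms by (simp only: powr_minus powr_half_sqrt less_imp_le q_def inverse_eq_divide)
    then have "ppow (1/2 - 1) r = 1 / q"
      using assms by (simp add: ppow_pos)
    moreover have "(1 + r) powr (- 1) = 1 / (1 + q\<^sup>2)"
      using assms q by (simp add: powr_minus inverse_eq_divide)
    ultimately show ?thesis by simp
  qed
  finally show ?thesis by (simp only: mult_ac)
qed

lemma curve_deriv_integrable:
  assumes "0 \<le> t"
  shows "integrable lborel (\<lambda>r. indicator {0<..} r * curve_deriv x t z r)"
proof (rule Bochner_Integration.integrable_bound)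
  show "integrable lborel (\<lambda>r. 4 * K * (1 + norm z) * (ppow (1/2 - 1) r * (1 + r) powr (- 1)))"
    using integrable_curve_majorant by (rule integrable_mult_right)
  show "AE r in lborel. norm (indicator {0<..} r * curve_deriv x t z r)
      \<le> norm (4 * K * (1 + norm z) * (ppow (1/2 - 1) r * (1 + r) powr (- 1)))"
    using curve_deriv_bound[OF assms] K_nonneg by (intro AE_I2) (auto simp: abs_mult split: split_indicator)
qed measurable

lemma integral_curve_deriv:
  assumes "0 \<le> t" "0 \<le> \<sigma>"
  shows "(LINT r|lborel. indicator {\<sigma><..} r * curve_deriv x t z r) = - U (curve x t z \<sigma>)"
proof -
  let ?k = "\<lambda>r. U (curve x t z r)"
  have cont: "continuous_on UNIV ?k"
    unfolding curve_def by (intro continuous_on_compose2[OF U_continuous] continuous_intros) auto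
  have "(LBINT r=ereal \<sigma>..\<infinity>. curve_deriv x t z r) = 0 - ?k \<sigma>"
  proof (rule interval_integral_FTC_integrable)
    fix r assume "ereal \<sigma> < ereal r"
    then have r: "0 < r" using assms by simp
    then show "(?k has_vector_derivative curve_deriv x t z r) (at r)"
      using has_curve_deriv by (simp add: has_real_derivative_iff_has_vector_derivative)
    have "continuous (at r) (\<lambda>r. DU (curve x t z r) h)" for h
    proof -
      have "continuous_on UNIV (\<lambda>r. DU (curve x t z r) h)"
        unfolding curve_def by (intro continuous_on_compose2[OF DU_cont] continuous_intros) auto
      then show ?thesis by (simp add: continuous_on_eq_continuous_at)
    qed
    then show "isCont (curve_deriv x t z) r"
      unfolding curve_deriv_def using r by (intro continuous_intros) auto
  next
    have "integrable lborel (\<lambda>r. indicator {\<sigma><..} r *\<^sub>R (indicator {0<..} r * curve_deriv x t z r))"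
      using curve_deriv_integrable[OF assms(1)] by (intro integrable_mult_indicator) auto
    also have "(\<lambda>r. indicator {\<sigma><..} r *\<^sub>R (indicator {0<..} r * curve_deriv x t z r))
      = (\<lambda>r. indicator {\<sigma><..} r *\<^sub>R curve_deriv x t z r)"
      using assms by (auto split: split_indicator)
    finally show "set_integrable lborel (einterval (ereal \<sigma>) \<infinity>) (curve_deriv x t z)"
      by (simp add: set_integrable_def)
  next
    have "(?k \<longlongrightarrow> ?k \<sigma>) (at_right \<sigma>)"
      using cont by (simp add: continuous_on_eq_continuous_at continuous_at filterlim_at_split)
    then show "((?k \<circ> real_of_ereal) \<longlongrightarrow> ?k \<sigma>) (at_right (ereal \<sigma>))"
      by (simp add: ereal_tendsto_simps1)
    have "(?k \<longlongrightarrow> 0) at_top"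
    proof (rule Lim_null_comparison)
      show "\<forall>\<^sub>F r in at_top. norm (?k r) \<le> K / (1 + (t + r)\<^sup>2)"
        using U_bound[of "curve x t z _"] by (intro always_eventually) (auto simp: curve_def)
      show "((\<lambda>r. K / (1 + (t + r)\<^sup>2)) \<longlongrightarrow> 0) at_top"
        by (intro tendsto_divide_0[OF tendsto_const] filterlim_at_top_imp_at_infinity
            filterlim_tendsto_add_at_top[OF tendsto_const] filterlim_pow_at_top filterlim_ident) simp
    qed
    then show "((?k \<circ> real_of_ereal) \<longlongrightarrow> 0) (at_left \<infinity>)"
      by (simp add: ereal_tendsto_simps1)
  qed simp
  then show ?thesis
    by (simp add: interval_lebesgue_integral_def set_lebesgue_integral_def)
qed

text \<open>
  A version of \<open>V\<close> that is meaningful, and equal to \<open>U (x, t)\<close>, also at \<open>\<sigma> = 0\<close>.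
\<close>
definition heat_flow :: "'a \<Rightarrow> real \<Rightarrow> real \<Rightarrow> real" where
  "heat_flow x t \<sigma> = (LINT z|lborel. heat_kernel 1 z * U (curve x t z \<sigma>))"

text \<open>
  The fundamental theorem of calculus holds along each curve, with value \<open>0\<close> at infinity, and
  averaging it over \<open>z\<close> commutes with the integral over \<open>r\<close>.
\<close>
lemma heat_flow_eq_tail_integral:
  assumes "0 \<le> t"
  shows "\<exists>\<psi>. integrable lborel \<psi> \<and>
    (\<forall>\<sigma>\<ge>0. heat_flow x t \<sigma> = - (LINT r|lborel. indicator {\<sigma><..} r * \<psi> r))"
proof (intro exI conjI allI impI)
  define k where "k = (\<lambda>(z, r). heat_kernel 1 z * (indicator {0<..} r * curve_deriv x t z r))"
  have [measurable]: "k \<in> borel_measurable (lborel \<Otimes>\<^sub>M lborel)"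
    unfolding k_def by measurable
  let ?m = "\<lambda>r::real. ppow (1/2 - 1) r * (1 + r) powr (- 1)"
  have k_int: "integrable (lborel \<Otimes>\<^sub>M lborel) k"
  proof (rule integrable_product_bound[OF _ integrable_heat_kernel_moment integrable_mult_right[OF integrable_curve_majorant, of "4 * K"]])
    fix z :: 'a and r :: real
    have "\<bar>indicator {0<..} r * curve_deriv x t z r\<bar> \<le> 4 * K * (1 + norm z) * ?m r"
      using curve_deriv_bound[OF assms, of r x z] K_nonneg by (cases "0 < r") (simp_all del: powr_minus)
    then have "\<bar>k (z, r)\<bar> \<le> heat_kernel 1 z * (4 * K * (1 + norm z) * ?m r)"
      unfolding k_def prod.case abs_mult[of "heat_kernel 1 z"] abs_of_nonneg[OF heat_kernel_nonneg]
      by (intro mult_left_mono) simp_all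
    then show "\<bar>k (z, r)\<bar> \<le> heat_kernel 1 z * (1 + norm z) * (4 * K * ?m r)"
      by (simp only: mult_ac)
  qed measurable
  define \<psi> where "\<psi> r = (LINT z|lborel. k (z, r))" for r
  show "integrable lborel \<psi>"
    unfolding \<psi>_def using lborel_pair.integrable_snd[of "\<lambda>z r. k (z, r)"] k_int by simp
  fix \<sigma> :: real assume \<sigma>: "0 \<le> \<sigma>"
  have int: "integrable (lborel \<Otimes>\<^sub>M lborel) (\<lambda>p. indicator (UNIV \<times> {\<sigma><..}) p *\<^sub>R k p)"
    using k_int by (rule integrable_mult_indicator[rotated]) (auto intro: pair_measureI)
  have "heat_flow x t \<sigma> = (LINT z|lborel. - (LINT r|lborel. indicator {\<sigma><..} r * k (z, r)))"
    unfolding heat_flow_def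
  proof (intro Bochner_Integration.integral_cong refl)
    fix z :: 'a
    have "(LINT r|lborel. indicator {\<sigma><..} r * k (z, r)) = (LINT r|lborel. heat_kernel 1 z * (indicator {\<sigma><..} r * curve_deriv x t z r))"
      using \<sigma> by (intro Bochner_Integration.integral_cong) (auto simp: k_def split: split_indicator)
    then show "heat_kernel 1 z * U (curve x t z \<sigma>) = - (LINT r|lborel. indicator {\<sigma><..} r * k (z, r))"
      by (simp add: integral_curve_deriv[OF assms \<sigma>])
  qed
  also have "\<dots> = - (LINT z|lborel. LINT r|lborel. indicator {\<sigma><..} r * k (z, r))"
    by simp
  also have "(LINT z|lborel. LINT r|lborel. indicator {\<sigma><..} r * k (z, r)) = (LINT r|lborel. LINT z|lborel. indicator {\<sigma><..} r * k (z, r))"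
    using lborel_pair.Fubini_integral[of "\<lambda>z r. indicator {\<sigma><..} r * k (z, r)"] int
    by (simp add: case_prod_unfold indicator_times)
  finally show "heat_flow x t \<sigma> = - (LINT r|lborel. indicator {\<sigma><..} r * \<psi> r)"
    by (simp add: \<psi>_def)
qed

section \<open>The fractional power and its inverse\<close>

definition heat_ext :: "'a \<Rightarrow> real \<Rightarrow> real \<Rightarrow> real" where
  "heat_ext x t \<tau> = (LINT y|lborel. heat_kernel \<tau> y * U (x - y, t + \<tau>))"

definition frac_power :: "real \<Rightarrow> 'a \<Rightarrow> real \<Rightarrow> real" where
  "frac_power s x t = 1 / Gamma (- s) * (LINT \<tau>|lborel. ppow (-1 - s) \<tau> * (heat_ext x t \<tau> - U (x, t)))"

lemma heat_ext_measurable [measurable (raw)]: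
  assumes [measurable]: "f \<in> borel_measurable M" "g \<in> borel_measurable M" "h \<in> borel_measurable M"
  shows "(\<lambda>w. heat_ext (f w) (g w) (h w)) \<in> borel_measurable M"
  unfolding heat_ext_def by measurable

lemma frac_power_measurable [measurable (raw)]:
  assumes [measurable]: "f \<in> borel_measurable M" "g \<in> borel_measurable M"
  shows "(\<lambda>w. frac_power s (f w) (g w)) \<in> borel_measurable M"
  unfolding frac_power_def by measurable

lemma integrable_heat_kernel_mult_U:
  assumes "0 < \<tau>" and [measurable]: "f \<in> borel_measurable borel" "g \<in> borel_measurable borel"
  shows "integrable lborel (\<lambda>y::'a. heat_kernel \<tau> y * U (f y, g y))"
proof (rule Bochner_Integration.integrable_bound)
  show "integrable lborel (\<lambda>y::'a. heat_kernel \<tau> y * K)"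
    using integrable_heat_kernel[OF assms(1)] by (rule integrable_mult_left)
  show "AE y::'a in lborel. norm (heat_kernel \<tau> y * U (f y, g y)) \<le> norm (heat_kernel \<tau> y * K)"
    using U_bounded K_nonneg by (intro AE_I2) (auto simp: abs_mult intro!: mult_left_mono)
qed measurable

lemma heat_ext_eq_flow:
  assumes "0 < \<tau>"
  shows "heat_ext x t \<tau> = heat_flow x t \<tau>"
  unfolding heat_ext_def heat_flow_def curve_def
  by (rule integral_heat_kernel_scale[OF assms]) measurable

lemma heat_flow_0: "heat_flow x t 0 = U (x, t)"
  by (simp add: heat_flow_def curve_def integral_heat_kernel)

text \<open>
  Each of the two Taylor remainders is of order \<open>\<tau>\<close>, and in the sum of the two linear terms the
  part of order \<open>\<surd>\<tau>\<close> cancels.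
\<close>
lemma second_difference_bound:
  assumes "0 < \<tau>" "\<tau> \<le> 1"
  shows "\<bar>U (x - sqrt \<tau> *\<^sub>R z, t + \<tau>) + U (x + sqrt \<tau> *\<^sub>R z, t + \<tau>) - 2 * U (x, t)\<bar> \<le> 2 * K * \<tau> * ((norm z)\<^sup>2 + 2)"
proof -
  define h1 h2 where "h1 = (- (sqrt \<tau> *\<^sub>R z), \<tau>)" and "h2 = (sqrt \<tau> *\<^sub>R z, \<tau>)"
  interpret bounded_linear "DU (x, t)" by (rule DU_linear)
  have "U (x - sqrt \<tau> *\<^sub>R z, t + \<tau>) + U (x + sqrt \<tau> *\<^sub>R z, t + \<tau>) - 2 * U (x, t)
    = (U ((x, t) + h1) - U (x, t) - DU (x, t) h1) + (U ((x, t) + h2) - U (x, t) - DU (x, t) h2) + DU (x, t) (h1 + h2)"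
    unfolding add by (simp add: h1_def h2_def)
  also have "\<bar>\<dots>\<bar> \<le> K * (norm h1)\<^sup>2 + K * (norm h2)\<^sup>2 + K * norm (h1 + h2) / (1 + (snd (x, t))\<^sup>2)"
    using Taylor[of "(x, t)" h1] Taylor[of "(x, t)" h2] DU_bound[of "(x, t)" "h1 + h2"] by linarith
  also have "K * norm (h1 + h2) / (1 + (snd (x, t))\<^sup>2) \<le> K * norm (h1 + h2) / 1"
    using K_nonneg by (intro divide_left_mono) (auto intro: add_pos_nonneg)
  also have "norm (h1 + h2) = 2 * \<tau>"
    using assms by (simp add: h1_def h2_def norm_Pair2)
  also have "(norm h1)\<^sup>2 = \<tau> * (norm z)\<^sup>2 + \<tau>\<^sup>2"
    using assms by (simp add: h1_def norm_Pair power_mult_distrib)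
  also have "(norm h2)\<^sup>2 = \<tau> * (norm z)\<^sup>2 + \<tau>\<^sup>2"
    using assms by (simp add: h2_def norm_Pair power_mult_distrib)
  also have "K * (\<tau> * (norm z)\<^sup>2 + \<tau>\<^sup>2) + K * (\<tau> * (norm z)\<^sup>2 + \<tau>\<^sup>2) + K * (2 * \<tau>) / 1
      \<le> 2 * K * \<tau> * ((norm z)\<^sup>2 + 2)"
  proof -
    have "K * \<tau>\<^sup>2 \<le> K * \<tau>"
      using assms K_nonneg by (intro mult_left_mono) (auto simp: power2_eq_square mult_left_le)
    then show ?thesis by (simp add: algebra_simps)
  qed
  finally show ?thesis by simp
qed

text \<open>
  Uniformity in \<open>x\<close> and \<open>t\<close>, and the order \<open>\<tau>\<close> rather than \<open>\<surd>\<tau>\<close>, make the defining integral of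
  the fractional power absolutely convergent for every \<open>s < 1\<close>, also after averaging.  The
  order \<open>\<tau>\<close> is obtained by symmetrizing in \<open>z \<mapsto> -z\<close>.
\<close>
lemma heat_ext_increment_bound:
  obtains L where "0 \<le> L"
    and "\<And>x t \<tau>. 0 < \<tau> \<Longrightarrow> \<bar>heat_ext x t \<tau> - U (x, t)\<bar> \<le> L * (\<tau> * (1 + \<tau>) powr (- 1))"
proof
  define M where "M = (LINT z|lborel. heat_kernel 1 (z::'a) * (norm z)\<^sup>2)"
  have M: "0 \<le> M" unfolding M_def by (intro integral_nonneg_AE) auto
  \<comment> \<open>The first summand serves \<open>\<tau> \<le> 1\<close>, where \<open>\<tau> \<le> 2\<tau>/(1+\<tau>)\<close>, the second one \<open>\<tau> > 1\<close>,
    where \<open>1 \<le> 2\<tau>/(1+\<tau>)\<close>.\<close>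
  define L where "L = 2 * (K * (M + 2)) + 4 * K"
  show "0 \<le> L" using M K_nonneg by (simp add: L_def)
  fix x t and \<tau> :: real assume \<tau>: "0 < \<tau>"
  let ?F = "\<lambda>z. heat_kernel 1 z * U (x - sqrt \<tau> *\<^sub>R z, t + \<tau>)"
  have int: "integrable lborel ?F" "integrable lborel (\<lambda>z. heat_kernel 1 z * U (x + sqrt \<tau> *\<^sub>R z, t + \<tau>))"
    by (intro integrable_heat_kernel_mult_U; simp)+
  have V: "heat_ext x t \<tau> = (LINT z|lborel. ?F z)"
    by (simp add: heat_ext_eq_flow[OF \<tau>] heat_flow_def curve_def)
  have V': "heat_ext x t \<tau> = (LINT z|lborel. heat_kernel 1 z * U (x + sqrt \<tau> *\<^sub>R z, t + \<tau>))"
    using integral_uminus[of ?F] by (simp add: V)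
  show "\<bar>heat_ext x t \<tau> - U (x, t)\<bar> \<le> L * (\<tau> * (1 + \<tau>) powr (- 1))"
  proof (cases "\<tau> \<le> 1")
    case True
    let ?G = "\<lambda>z. heat_kernel 1 z * U (x + sqrt \<tau> *\<^sub>R z, t + \<tau>)"
    let ?D = "\<lambda>z. heat_kernel 1 z * (U (x - sqrt \<tau> *\<^sub>R z, t + \<tau>) + U (x + sqrt \<tau> *\<^sub>R z, t + \<tau>) - 2 * U (x, t))"
    have D: "?D = (\<lambda>z. ?F z + ?G z - heat_kernel 1 z * (2 * U (x, t)))"
      by (simp add: fun_eq_iff algebra_simps)
    have iC: "integrable lborel (\<lambda>z::'a. heat_kernel 1 z * (2 * U (x, t)))"
      by (intro integrable_mult_left integrable_heat_kernel) simp
    have iFG: "integrable lborel (\<lambda>z. ?F z + ?G z)"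
      using int by (rule Bochner_Integration.integrable_add)
    have iD: "integrable lborel ?D"
      unfolding D using iFG iC by (rule Bochner_Integration.integrable_diff)
    have "(LINT z|lborel. heat_kernel 1 (z::'a) * (2 * U (x, t))) = 2 * U (x, t)"
      by (simp add: integral_heat_kernel)
    then have "(LINT z|lborel. ?D z) = heat_ext x t \<tau> + heat_ext x t \<tau> - 2 * U (x, t)"
      unfolding D Bochner_Integration.integral_diff[OF iFG iC] Bochner_Integration.integral_add[OF int]
      by (simp only: V[symmetric] V'[symmetric])
    then have "2 * (heat_ext x t \<tau> - U (x, t)) = (LINT z|lborel. ?D z)"
      by simp
    then have "\<bar>2 * (heat_ext x t \<tau> - U (x, t))\<bar> \<le> (LINT z|lborel. \<bar>?D z\<bar>)"
      by (simp only: integral_abs_bound)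
    also have "\<dots> \<le> (LINT z|lborel. 2 * K * \<tau> * (heat_kernel 1 z * (norm z)\<^sup>2 + 2 * heat_kernel 1 (z::'a)))"
    proof (rule integral_mono)
      show "integrable lborel (\<lambda>z. \<bar>?D z\<bar>)" using iD by (rule integrable_abs)
      show "integrable lborel (\<lambda>z::'a. 2 * K * \<tau> * (heat_kernel 1 z * (norm z)\<^sup>2 + 2 * heat_kernel 1 z))"
        by (intro integrable_mult_right Bochner_Integration.integrable_add integrable_heat_kernel_second_moment integrable_heat_kernel) simp
      show "\<bar>?D z\<bar> \<le> 2 * K * \<tau> * (heat_kernel 1 z * (norm z)\<^sup>2 + 2 * heat_kernel 1 z)" for z
      proof -
        have "\<bar>?D z\<bar> \<le> heat_kernel 1 z * (2 * K * \<tau> * ((norm z)\<^sup>2 + 2))"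
          unfolding abs_mult[of "heat_kernel 1 z"] abs_of_nonneg[OF heat_kernel_nonneg]
          by (rule mult_left_mono[OF second_difference_bound[OF \<tau> True] heat_kernel_nonneg])
        then show ?thesis by (simp only: distrib_left mult_ac)
      qed
    qed
    also have "\<dots> = 2 * (K * (M + 2) * \<tau>)"
      by (simp add: M_def integrable_heat_kernel_second_moment integrable_heat_kernel integral_heat_kernel)
    finally have "\<bar>heat_ext x t \<tau> - U (x, t)\<bar> \<le> K * (M + 2) * \<tau>" by simp
    also have "\<dots> \<le> K * (M + 2) * (2 * (\<tau> * (1 + \<tau>) powr (- 1)))"
    proof (rule mult_left_mono)
      have "\<tau> * 1 \<le> \<tau> * (2 / (1 + \<tau>))"
        using \<tau> True by (intro mult_left_mono) auto
      then show "\<tau> \<le> 2 * (\<tau> * (1 + \<tau>) powr (- 1))" 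
        using \<tau> by (simp add: powr_minus inverse_eq_divide mult.commute)
      show "0 \<le> K * (M + 2)" using K_nonneg M by simp
    qed
    also have "\<dots> = (2 * (K * (M + 2))) * (\<tau> * (1 + \<tau>) powr (- 1))" by simp
    also have "\<dots> \<le> L * (\<tau> * (1 + \<tau>) powr (- 1))"
      using \<tau> K_nonneg by (intro mult_right_mono) (auto simp: L_def)
    finally show ?thesis .
  next
    case False
    have "\<bar>heat_ext x t \<tau>\<bar> \<le> (LINT z|lborel. \<bar>?F z\<bar>)"
      unfolding V by (rule integral_abs_bound)
    also have "\<dots> \<le> (LINT z|lborel. K * heat_kernel 1 (z::'a))"
    proof (rule integral_mono)
      show "integrable lborel (\<lambda>z. \<bar>?F z\<bar>)" using int(1) by (rule integrable_abs)
      show "integrable lborel (\<lambda>z::'a. K * heat_kernel 1 z)"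
        by (intro integrable_mult_right integrable_heat_kernel) simp
      show "\<bar>?F z\<bar> \<le> K * heat_kernel 1 z" for z
        unfolding abs_mult abs_of_nonneg[OF heat_kernel_nonneg] mult.commute[of K]
        by (rule mult_left_mono[OF U_bounded heat_kernel_nonneg])
    qed
    also have "\<dots> = K" by (simp add: integral_heat_kernel)
    finally have "\<bar>heat_ext x t \<tau> - U (x, t)\<bar> \<le> 2 * K * 1"
      using U_bounded[of "(x, t)"] by linarith
    also have "\<dots> \<le> 2 * K * (2 * (\<tau> * (1 + \<tau>) powr (- 1)))"
    proof (rule mult_left_mono)
      show "1 \<le> 2 * (\<tau> * (1 + \<tau>) powr (- 1))"
        using False by (simp add: powr_minus divide_simps)
    qed (use K_nonneg in auto)
    also have "\<dots> = 4 * K * (\<tau> * (1 + \<tau>) powr (- 1))" by simp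
    also have "\<dots> \<le> L * (\<tau> * (1 + \<tau>) powr (- 1))"
      using \<tau> K_nonneg M by (intro mult_right_mono) (auto simp: L_def)
    finally show ?thesis .
  qed
qed

text \<open>
  Averaging \<open>V\<close> at time \<open>t + \<sigma>\<close> convolves the two kernels, and both time shifts add up to
  \<open>\<sigma> + \<tau>\<close>.
\<close>
lemma heat_ext_semigroup:
  assumes "0 < \<sigma>" "0 < \<tau>"
  shows "(LINT y|lborel. heat_kernel \<sigma> y * heat_ext (x - y) (t + \<sigma>) \<tau>) = heat_ext x t (\<sigma> + \<tau>)"
proof -
  define k where "k = (\<lambda>(y, w). heat_kernel \<tau> (w - y) * heat_kernel \<sigma> y * U (x - w, t + \<sigma> + \<tau>))"
  have [measurable]: "k \<in> borel_measurable (lborel \<Otimes>\<^sub>M lborel)"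
    unfolding k_def by measurable
  have int: "integrable (lborel \<Otimes>\<^sub>M lborel) k"
  proof (rule integrableI_bounded)
    have "(\<integral>\<^sup>+p. ennreal (norm (k p)) \<partial>(lborel \<Otimes>\<^sub>M lborel)) = (\<integral>\<^sup>+w. \<integral>\<^sup>+y. ennreal (norm (k (y, w))) \<partial>lborel \<partial>lborel)"
      by (rule lborel_pair.nn_integral_snd[symmetric]) measurable
    also have "\<dots> \<le> (\<integral>\<^sup>+w. \<integral>\<^sup>+y. ennreal (heat_kernel \<tau> (w - y) * heat_kernel \<sigma> (y::'a)) * ennreal K \<partial>lborel \<partial>lborel)"
      using U_bounded by (intro nn_integral_mono) (auto simp: k_def abs_mult ennreal_mult'[symmetric] intro!: ennreal_leI mult_left_mono)
    also have "\<dots> = (\<integral>\<^sup>+w. ennreal (heat_kernel (\<tau> + \<sigma>) (w::'a)) * ennreal K \<partial>lborel)"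
      using has_bochner_integral_heat_kernel_convolution[OF assms(2,1), where 'a='a]
      by (simp add: nn_integral_multc nn_integral_eq_integral has_bochner_integral_iff)
    also have "\<dots> < \<infinity>"
      using assms by (simp add: nn_integral_multc nn_integral_heat_kernel)
    finally show "(\<integral>\<^sup>+p. ennreal (norm (k p)) \<partial>(lborel \<Otimes>\<^sub>M lborel)) < \<infinity>" .
  qed measurable
  have "(LINT y|lborel. heat_kernel \<sigma> y * heat_ext (x - y) (t + \<sigma>) \<tau>) = (LINT y|lborel. LINT w|lborel. k (y, w))"
  proof (intro Bochner_Integration.integral_cong refl)
    fix y :: 'a
    have "(LINT w|lborel. k (y, w)) = (LINT w|lborel. k (y, y + w))"
      by (rule integral_shift[symmetric]) measurable
    also have "\<dots> = (LINT w|lborel. heat_kernel \<sigma> y * (heat_kernel \<tau> w * U (x - y - w, t + \<sigma> + \<tau>)))"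
      by (intro Bochner_Integration.integral_cong) (auto simp: k_def algebra_simps)
    finally show "heat_kernel \<sigma> y * heat_ext (x - y) (t + \<sigma>) \<tau> = (LINT w|lborel. k (y, w))"
      by (simp add: heat_ext_def)
  qed
  also have "\<dots> = (LINT w|lborel. LINT y|lborel. k (y, w))"
    using lborel_pair.Fubini_integral[of "\<lambda>y w. k (y, w)"] int by simp
  also have "\<dots> = heat_ext x t (\<sigma> + \<tau>)"
    using has_bochner_integral_heat_kernel_convolution[OF assms(2,1), where 'a='a]
    by (simp add: k_def heat_ext_def has_bochner_integral_iff add.commute[of \<sigma> \<tau>] add.assoc)
  finally show ?thesis .
qed

text \<open>
  The fractional power commutes with the space-time heat semigroup: averaging passes under the
  integral over \<open>\<tau>\<close>, where the semigroup law turns \<open>V(\<cdot>,t+\<sigma>,\<tau>)\<close> into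
  \<open>V(x,t,\<sigma>+\<tau>)\<close>.  The right-hand side is the Marchaud derivative of \<open>V(x,t,\<cdot>)\<close> at \<open>\<sigma>\<close>.
\<close>
lemma heat_average_frac_power:
  assumes s: "0 < s" "s < 1" and \<sigma>: "0 < \<sigma>"
  shows "integrable lborel (\<lambda>y. heat_kernel \<sigma> y * frac_power s (x - y) (t + \<sigma>))"
    and "(LINT y|lborel. heat_kernel \<sigma> y * frac_power s (x - y) (t + \<sigma>))
      = (LINT \<tau>|lborel. ppow (-1 - s) \<tau> * (heat_ext x t (\<sigma> + \<tau>) - heat_ext x t \<sigma>)) / Gamma (- s)"
proof -
  obtain L where L: "0 \<le> L"
    "\<And>x t \<tau>. 0 < \<tau> \<Longrightarrow> \<bar>heat_ext x t \<tau> - U (x, t)\<bar> \<le> L * (\<tau> * (1 + \<tau>) powr (- 1))"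
    by (rule heat_ext_increment_bound) blast
  define k where "k = (\<lambda>(y, \<tau>). heat_kernel \<sigma> y * (ppow (-1 - s) \<tau> * (heat_ext (x - y) (t + \<sigma>) \<tau> - U (x - y, t + \<sigma>))))"
  have [measurable]: "k \<in> borel_measurable (lborel \<Otimes>\<^sub>M lborel)"
    unfolding k_def by measurable
  have int: "integrable (lborel \<Otimes>\<^sub>M lborel) k"
  proof (rule integrable_product_bound[OF _ integrable_heat_kernel[OF \<sigma>] integrable_mult_right[OF integrable_Weyl_weight[OF s], of L]])
    fix y :: 'a and \<tau> :: real
    have "ppow (-1 - s) \<tau> * \<bar>heat_ext (x - y) (t + \<sigma>) \<tau> - U (x - y, t + \<sigma>)\<bar> \<le> L * (ppow (- s) \<tau> * (1 + \<tau>) powr (- 1))"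
    proof (cases "0 < \<tau>")
      case True
      then have "ppow (-1 - s) \<tau> * \<tau> = ppow (- s) \<tau>"
        by (simp add: ppow_pos powr_mult_base mult.commute)
      then show ?thesis
        using mult_left_mono[OF L(2)[OF True, of "x - y" "t + \<sigma>"], of "ppow (-1 - s) \<tau>"]
        by (metis mult.assoc mult.left_commute ppow_nonneg)
    qed (simp add: ppow_nonpos)
    then show "\<bar>k (y, \<tau>)\<bar> \<le> heat_kernel \<sigma> y * (L * (ppow (- s) \<tau> * (1 + \<tau>) powr (- 1)))"
      unfolding k_def prod.case abs_mult abs_of_nonneg[OF heat_kernel_nonneg] abs_of_nonneg[OF ppow_nonneg]
      by (rule mult_left_mono) simp
  qed measurable
  have frac_eq: "heat_kernel \<sigma> y * frac_power s (x - y) (t + \<sigma>) = (LINT \<tau>|lborel. k (y, \<tau>)) / Gamma (- s)" for y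
    by (simp add: frac_power_def k_def)
  show "integrable lborel (\<lambda>y. heat_kernel \<sigma> y * frac_power s (x - y) (t + \<sigma>))"
    unfolding frac_eq using lborel_pair.integrable_fst'[OF int] by simp
  have "(LINT y|lborel. LINT \<tau>|lborel. k (y, \<tau>)) = (LINT \<tau>|lborel. LINT y|lborel. k (y, \<tau>))"
    using lborel_pair.Fubini_integral[of "\<lambda>y \<tau>. k (y, \<tau>)"] int by simp
  also have "\<dots> = (LINT \<tau>|lborel. ppow (-1 - s) \<tau> * (heat_ext x t (\<sigma> + \<tau>) - heat_ext x t \<sigma>))"
  proof (intro Bochner_Integration.integral_cong refl)
    fix \<tau> :: real
    show "(LINT y|lborel. k (y, \<tau>)) = ppow (-1 - s) \<tau> * (heat_ext x t (\<sigma> + \<tau>) - heat_ext x t \<sigma>)"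
    proof (cases "0 < \<tau>")
      case True
      have i1: "integrable lborel (\<lambda>y. heat_kernel \<sigma> y * U (x - y, t + \<sigma>))"
        by (rule integrable_heat_kernel_mult_U[OF \<sigma>]) simp_all
      have "integrable lborel (\<lambda>y. heat_kernel \<sigma> y * (heat_ext (x - y) (t + \<sigma>) \<tau> - U (x - y, t + \<sigma>)))"
      proof (rule Bochner_Integration.integrable_bound)
        show "integrable lborel (\<lambda>y::'a. heat_kernel \<sigma> y * (L * (\<tau> * (1 + \<tau>) powr (- 1))))"
          using integrable_heat_kernel[OF \<sigma>] by (rule integrable_mult_left)
        show "AE y in lborel. norm (heat_kernel \<sigma> y * (heat_ext (x - y) (t + \<sigma>) \<tau> - U (x - y, t + \<sigma>)))
          \<le> norm (heat_kernel \<sigma> y * (L * (\<tau> * (1 + \<tau>) powr (- 1))))"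
        proof (rule AE_I2)
          fix y
          show "norm (heat_kernel \<sigma> y * (heat_ext (x - y) (t + \<sigma>) \<tau> - U (x - y, t + \<sigma>)))
            \<le> norm (heat_kernel \<sigma> y * (L * (\<tau> * (1 + \<tau>) powr (- 1))))"
            unfolding real_norm_def abs_mult[of "heat_kernel \<sigma> y"]
            by (rule mult_left_mono[OF order_trans[OF L(2)[OF True] abs_ge_self] abs_ge_zero])
        qed
      qed measurable
      from Bochner_Integration.integrable_add[OF this i1]
      have i2: "integrable lborel (\<lambda>y. heat_kernel \<sigma> y * heat_ext (x - y) (t + \<sigma>) \<tau>)"
        by (simp add: right_diff_distrib)
      have "(LINT y|lborel. k (y, \<tau>)) = (LINT y|lborel. ppow (-1 - s) \<tau> *
          (heat_kernel \<sigma> y * heat_ext (x - y) (t + \<sigma>) \<tau> - heat_kernel \<sigma> y * U (x - y, t + \<sigma>)))"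
        by (simp add: k_def right_diff_distrib mult.left_commute)
      also have "\<dots> = ppow (-1 - s) \<tau> * (heat_ext x t (\<sigma> + \<tau>) - heat_ext x t \<sigma>)"
        using i1 i2 heat_ext_semigroup[OF \<sigma> True, of x t] by (simp add: heat_ext_def[of x t \<sigma>])
      finally show ?thesis .
    qed (simp add: k_def ppow_nonpos)
  qed
  finally show "(LINT y|lborel. heat_kernel \<sigma> y * frac_power s (x - y) (t + \<sigma>))
      = (LINT \<tau>|lborel. ppow (-1 - s) \<tau> * (heat_ext x t (\<sigma> + \<tau>) - heat_ext x t \<sigma>)) / Gamma (- s)"
    unfolding frac_eq by simp
qed

text \<open>
  This is \<open>u = \<Gamma>(s)\<^bsup>-1\<^esup> \<integral> \<sigma>\<^bsup>s-1\<^esup> T\<^sub>\<sigma> f d\<sigma>\<close> with absolute values inside the integrals.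
\<close>
lemma pointwise_bound:
  assumes s: "0 < s" "s < 1" and t: "0 \<le> t"
  shows "ennreal (Gamma s * \<bar>U (x, t)\<bar>) \<le>
    (\<integral>\<^sup>+\<sigma>. ennreal (ppow (s - 1) \<sigma>) *
      (\<integral>\<^sup>+y. ennreal (heat_kernel \<sigma> y) * ennreal \<bar>frac_power s (x - y) (t + \<sigma>)\<bar> \<partial>lborel) \<partial>lborel)"
proof -
  let ?D = "\<lambda>\<sigma>. LINT \<tau>|lborel. ppow (-1 - s) \<tau> * (heat_flow x t (\<sigma> + \<tau>) - heat_flow x t \<sigma>)"
  obtain \<psi> where \<psi>: "integrable lborel \<psi>"
    "\<And>\<sigma>. 0 \<le> \<sigma> \<Longrightarrow> heat_flow x t \<sigma> = - (LINT r|lborel. indicator {\<sigma><..} r * \<psi> r)"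
    using heat_flow_eq_tail_integral[OF t, of x] by blast
  have "ennreal (Gamma s * \<bar>U (x, t)\<bar>) \<le> (\<integral>\<^sup>+\<sigma>. ennreal (ppow (s - 1) \<sigma> * \<bar>?D \<sigma> / Gamma (- s)\<bar>) \<partial>lborel)"
    using marchaud_inversion[OF s \<psi>] by (simp add: heat_flow_0)
  also have "\<dots> \<le> (\<integral>\<^sup>+\<sigma>. ennreal (ppow (s - 1) \<sigma>) *
      (\<integral>\<^sup>+y. ennreal (heat_kernel \<sigma> y) * ennreal \<bar>frac_power s (x - y) (t + \<sigma>)\<bar> \<partial>lborel) \<partial>lborel)"
  proof (rule nn_integral_mono)
    fix \<sigma> :: real
    show "ennreal (ppow (s - 1) \<sigma> * \<bar>?D \<sigma> / Gamma (- s)\<bar>) \<le> ennreal (ppow (s - 1) \<sigma>) *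
      (\<integral>\<^sup>+y. ennreal (heat_kernel \<sigma> y) * ennreal \<bar>frac_power s (x - y) (t + \<sigma>)\<bar> \<partial>lborel)"
    proof (cases "0 < \<sigma>")
      case True
      have "?D \<sigma> = (LINT \<tau>|lborel. ppow (-1 - s) \<tau> * (heat_ext x t (\<sigma> + \<tau>) - heat_ext x t \<sigma>))"
        using True by (intro Bochner_Integration.integral_cong) (auto simp: heat_ext_eq_flow ppow_def)
      then have "?D \<sigma> / Gamma (- s) = (LINT y|lborel. heat_kernel \<sigma> y * frac_power s (x - y) (t + \<sigma>))"
        by (simp add: heat_average_frac_power(2)[OF s True])
      then have "ennreal \<bar>?D \<sigma> / Gamma (- s)\<bar> \<le> (\<integral>\<^sup>+y. ennreal (norm (heat_kernel \<sigma> y * frac_power s (x - y) (t + \<sigma>))) \<partial>lborel)"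
        using integral_norm_bound_ennreal[OF heat_average_frac_power(1)[OF s True, of x t]] by simp
      also have "\<dots> = (\<integral>\<^sup>+y. ennreal (heat_kernel \<sigma> y) * ennreal \<bar>frac_power s (x - y) (t + \<sigma>)\<bar> \<partial>lborel)"
        by (simp add: abs_mult ennreal_mult)
      finally show ?thesis
        unfolding ennreal_mult'[OF ppow_nonneg] by (rule mult_left_mono) simp
    qed (simp add: ppow_nonpos)
  qed
  finally show ?thesis .
qed

end

section \<open>The Hardy inequality for fractional integrals along the heat flow\<close>

text \<open>
  A Schur test for the kernel \<open>\<sigma>\<^bsup>s-1\<^esup> G\<^sub>\<sigma>(y)\<close>.  The exponent \<open>l = s + \<eta>/2\<close> is the one for which the
  integral over \<open>\<sigma>\<close> for fixed \<open>t\<close> and the integral over \<open>t\<close> for fixed \<open>r = t + \<sigma>\<close> have the same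
  constant \<open>Beta s (\<eta>/2)\<close>, up to powers of \<open>t\<close> and \<open>r\<close>.
\<close>
lemma fractional_Hardy:
  fixes u F :: "'a::euclidean_space \<times> real \<Rightarrow> ennreal"
  assumes s: "0 < s" and \<eta>: "0 < \<eta>"
    and [measurable]: "u \<in> borel_measurable (borel \<Otimes>\<^sub>M borel)" "F \<in> borel_measurable (borel \<Otimes>\<^sub>M borel)"
    and rep: "\<And>x t. 0 < t \<Longrightarrow> ennreal (Gamma s) * u (x, t) \<le>
      (\<integral>\<^sup>+\<sigma>. ennreal (ppow (s - 1) \<sigma>) * (\<integral>\<^sup>+y. ennreal (heat_kernel \<sigma> y) * F (x - y, t + \<sigma>) \<partial>lborel) \<partial>lborel)"
  shows "(\<integral>\<^sup>+t. ennreal (ppow (\<eta> - 1) t) * (\<integral>\<^sup>+x. ennreal (heat_kernel t x) * (u (x, t))\<^sup>2 \<partial>lborel) \<partial>lborel)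
    \<le> ennreal ((Gamma (\<eta> / 2) / Gamma (s + \<eta> / 2))\<^sup>2) *
      (\<integral>\<^sup>+t. ennreal (ppow (2 * s + \<eta> - 1) t) * (\<integral>\<^sup>+x. ennreal (heat_kernel t x) * (F (x, t))\<^sup>2 \<partial>lborel) \<partial>lborel)"
proof -
  define l where "l = s + \<eta> / 2"
  define B where "B = Beta s (\<eta> / 2)"
  define N where "N r = (\<integral>\<^sup>+z. ennreal (heat_kernel r z) * (F (z, r))\<^sup>2 \<partial>lborel)" for r
  define g where "g = Gamma s"
  have g: "0 < g" using s by (simp add: g_def)
  have B: "0 \<le> B" using s \<eta> by (simp add: B_def Beta_def)
  have N_meas [measurable]: "N \<in> borel_measurable borel"
    unfolding N_def by measurable
  define S where "S x t \<sigma> = (\<integral>\<^sup>+y. ennreal (heat_kernel \<sigma> y) * (F (x - y, t + \<sigma>))\<^sup>2 \<partial>lborel)" for x t \<sigma>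
  have S_meas [measurable (raw)]: "(\<lambda>w. S (f w) (g w) (h w)) \<in> borel_measurable M"
    if [measurable]: "f \<in> borel_measurable M" "g \<in> borel_measurable M" "h \<in> borel_measurable M" for f g h and M :: "'m measure"
    unfolding S_def by measurable
  let ?w = "\<lambda>t \<sigma>. ppow (s - 1) \<sigma> * (t + \<sigma>) powr l"
  have point: "ennreal (g\<^sup>2) * (u (x, t))\<^sup>2 \<le> ennreal (B * t powr (s - l)) * (\<integral>\<^sup>+\<sigma>. ennreal (?w t \<sigma>) * S x t \<sigma> \<partial>lborel)"
    if t: "0 < t" for x t
  proof -
    let ?A = "\<lambda>\<sigma>. \<integral>\<^sup>+y. ennreal (heat_kernel \<sigma> y) * F (x - y, t + \<sigma>) \<partial>lborel"
    have jensen: "(?A \<sigma>)\<^sup>2 \<le> S x t \<sigma>" if "0 < \<sigma>" for \<sigma>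
      using weighted_Cauchy_Schwarz[of "heat_kernel \<sigma>" lborel "heat_kernel \<sigma>" "\<lambda>y. F (x - y, t + \<sigma>)"]
      by (simp add: nn_integral_heat_kernel[OF that] S_def)
    have "ennreal (g\<^sup>2) * (u (x, t))\<^sup>2 = (ennreal g * u (x, t))\<^sup>2"
      using g by (simp add: power_mult_distrib ennreal_power)
    also have "\<dots> \<le> (\<integral>\<^sup>+\<sigma>. ennreal (ppow (s - 1) \<sigma>) * ?A \<sigma> \<partial>lborel)\<^sup>2"
      unfolding g_def by (intro power_mono rep t) simp
    also have "\<dots> = (\<integral>\<^sup>+\<sigma>. ennreal (sqrt ((ppow (s - 1) \<sigma> * (t + \<sigma>) powr (- l)) * ?w t \<sigma>)) * ?A \<sigma> \<partial>lborel)\<^sup>2"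
    proof -
      have "sqrt ((ppow (s - 1) \<sigma> * (t + \<sigma>) powr (- l)) * ?w t \<sigma>) = ppow (s - 1) \<sigma>" for \<sigma>
      proof (cases "0 < \<sigma>")
        case True
        then have "(ppow (s - 1) \<sigma> * (t + \<sigma>) powr (- l)) * ?w t \<sigma> = (ppow (s - 1) \<sigma>)\<^sup>2"
          using t by (simp add: powr_minus power2_eq_square)
        then show ?thesis by simp
      qed (simp add: ppow_nonpos)
      then show ?thesis by simp
    qed
    also have "\<dots> \<le> (\<integral>\<^sup>+\<sigma>. ennreal (ppow (s - 1) \<sigma> * (t + \<sigma>) powr (- l)) \<partial>lborel)
        * (\<integral>\<^sup>+\<sigma>. ennreal (?w t \<sigma>) * (?A \<sigma>)\<^sup>2 \<partial>lborel)"
      by (rule weighted_Cauchy_Schwarz) auto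
    also have "(\<integral>\<^sup>+\<sigma>. ennreal (ppow (s - 1) \<sigma> * (t + \<sigma>) powr (- l)) \<partial>lborel) = ennreal (B * t powr (s - l))"
      using nn_integral_Beta_Weyl[of s l t] s \<eta> t by (simp add: l_def B_def)
    also have "(\<integral>\<^sup>+\<sigma>. ennreal (?w t \<sigma>) * (?A \<sigma>)\<^sup>2 \<partial>lborel) \<le> (\<integral>\<^sup>+\<sigma>. ennreal (?w t \<sigma>) * S x t \<sigma> \<partial>lborel)"
    proof (rule nn_integral_mono)
      fix \<sigma> :: real
      show "ennreal (?w t \<sigma>) * (?A \<sigma>)\<^sup>2 \<le> ennreal (?w t \<sigma>) * S x t \<sigma>"
        by (cases "0 < \<sigma>") (auto intro!: mult_left_mono jensen simp: ppow_nonpos)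
    qed
    finally show ?thesis by (simp add: mult_left_mono)
  qed
  have slice: "ennreal (g\<^sup>2) * (\<integral>\<^sup>+x. ennreal (heat_kernel t x) * (u (x, t))\<^sup>2 \<partial>lborel)
      \<le> ennreal (B * t powr (s - l)) * (\<integral>\<^sup>+r. ennreal (ppow (s - 1) (r - t) * r powr l) * N r \<partial>lborel)"
    if t: "0 < t" for t
  proof -
    have "ennreal (g\<^sup>2) * (\<integral>\<^sup>+x. ennreal (heat_kernel t x) * (u (x, t))\<^sup>2 \<partial>lborel)
      = (\<integral>\<^sup>+x. ennreal (heat_kernel t x) * (ennreal (g\<^sup>2) * (u (x, t))\<^sup>2) \<partial>lborel)"
      by (subst nn_integral_cmult[symmetric]) (simp_all add: mult.left_commute)
    also have "\<dots> \<le> (\<integral>\<^sup>+x. ennreal (heat_kernel t x) * (ennreal (B * t powr (s - l)) * (\<integral>\<^sup>+\<sigma>. ennreal (?w t \<sigma>) * S x t \<sigma> \<partial>lborel)) \<partial>lborel)"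
      by (intro nn_integral_mono mult_left_mono point t) simp
    also have "\<dots> = ennreal (B * t powr (s - l)) * (\<integral>\<^sup>+x. ennreal (heat_kernel t x) * (\<integral>\<^sup>+\<sigma>. ennreal (?w t \<sigma>) * S x t \<sigma> \<partial>lborel) \<partial>lborel)"
      by (subst nn_integral_cmult[symmetric]) (simp_all add: mult.left_commute)
    also have "(\<integral>\<^sup>+x. ennreal (heat_kernel t x) * (\<integral>\<^sup>+\<sigma>. ennreal (?w t \<sigma>) * S x t \<sigma> \<partial>lborel) \<partial>lborel)
      = (\<integral>\<^sup>+x. \<integral>\<^sup>+\<sigma>. ennreal (heat_kernel t x) * (ennreal (?w t \<sigma>) * S x t \<sigma>) \<partial>lborel \<partial>lborel)"
      by (intro nn_integral_cong nn_integral_cmult[symmetric]) measurable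
    also have "\<dots> = (\<integral>\<^sup>+\<sigma>. \<integral>\<^sup>+x. ennreal (heat_kernel t x) * (ennreal (?w t \<sigma>) * S x t \<sigma>) \<partial>lborel \<partial>lborel)"
      by (rule lborel_pair.Fubini') measurable
    also have "\<dots> = (\<integral>\<^sup>+\<sigma>. ennreal (?w t \<sigma>) * N (t + \<sigma>) \<partial>lborel)"
    proof (rule nn_integral_cong)
      fix \<sigma> :: real
      show "(\<integral>\<^sup>+x. ennreal (heat_kernel t x) * (ennreal (?w t \<sigma>) * S x t \<sigma>) \<partial>lborel) = ennreal (?w t \<sigma>) * N (t + \<sigma>)"
      proof (cases "0 < \<sigma>")
        case True
        have "(\<integral>\<^sup>+x. ennreal (heat_kernel t x) * (ennreal (?w t \<sigma>) * S x t \<sigma>) \<partial>lborel)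
          = ennreal (?w t \<sigma>) * (\<integral>\<^sup>+x. ennreal (heat_kernel t x) * S x t \<sigma> \<partial>lborel)"
          by (subst nn_integral_cmult[symmetric]) (simp_all add: mult.left_commute)
        also have "(\<integral>\<^sup>+x. ennreal (heat_kernel t x) * S x t \<sigma> \<partial>lborel) = N (t + \<sigma>)"
          unfolding S_def N_def by (rule heat_kernel_semigroup[OF t True, where h="\<lambda>z. (F (z, t + \<sigma>))\<^sup>2"]) measurable
        finally show ?thesis .
      qed (simp add: ppow_nonpos)
    qed
    also have "\<dots> = (\<integral>\<^sup>+r. ennreal (ppow (s - 1) (r - t) * r powr l) * N r \<partial>lborel)"
      using nn_integral_shift[of "\<lambda>r. ennreal (ppow (s - 1) (r - t) * r powr l) * N r" t] by simp
    finally show ?thesis .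
  qed
  have "ennreal (g\<^sup>2) * (\<integral>\<^sup>+t. ennreal (ppow (\<eta> - 1) t) * (\<integral>\<^sup>+x. ennreal (heat_kernel t x) * (u (x, t))\<^sup>2 \<partial>lborel) \<partial>lborel)
    = (\<integral>\<^sup>+t. ennreal (ppow (\<eta> - 1) t) * (ennreal (g\<^sup>2) * (\<integral>\<^sup>+x. ennreal (heat_kernel t x) * (u (x, t))\<^sup>2 \<partial>lborel)) \<partial>lborel)"
    by (subst nn_integral_cmult[symmetric]) (simp_all add: mult.left_commute)
  also have "\<dots> \<le> (\<integral>\<^sup>+t. \<integral>\<^sup>+r. ennreal B * (ennreal (ppow (\<eta> / 2 - 1) t * ppow (s - 1) (r - t)) * (ennreal (r powr l) * N r)) \<partial>lborel \<partial>lborel)"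
  proof (rule nn_integral_mono)
    fix t :: real
    show "ennreal (ppow (\<eta> - 1) t) * (ennreal (g\<^sup>2) * (\<integral>\<^sup>+x. ennreal (heat_kernel t x) * (u (x, t))\<^sup>2 \<partial>lborel))
      \<le> (\<integral>\<^sup>+r. ennreal B * (ennreal (ppow (\<eta> / 2 - 1) t * ppow (s - 1) (r - t)) * (ennreal (r powr l) * N r)) \<partial>lborel)"
    proof (cases "0 < t")
      case True
      have "ppow (\<eta> - 1) t * (B * t powr (s - l)) = B * ppow (\<eta> / 2 - 1) t"
        using True by (simp add: ppow_pos l_def mult.left_commute flip: powr_add)
      then have e: "ennreal (ppow (\<eta> - 1) t) * ennreal (B * t powr (s - l)) = ennreal B * ennreal (ppow (\<eta> / 2 - 1) t)"
        using B by (simp add: ennreal_mult'[symmetric])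
      have "ennreal (ppow (\<eta> - 1) t) * (ennreal (g\<^sup>2) * (\<integral>\<^sup>+x. ennreal (heat_kernel t x) * (u (x, t))\<^sup>2 \<partial>lborel))
        \<le> ennreal (ppow (\<eta> - 1) t) * (ennreal (B * t powr (s - l)) * (\<integral>\<^sup>+r. ennreal (ppow (s - 1) (r - t) * r powr l) * N r \<partial>lborel))"
        by (rule mult_left_mono[OF slice[OF True]]) simp
      also have "\<dots> = (ennreal B * ennreal (ppow (\<eta> / 2 - 1) t)) * (\<integral>\<^sup>+r. ennreal (ppow (s - 1) (r - t) * r powr l) * N r \<partial>lborel)"
        by (simp only: mult.assoc[symmetric] e)
      also have "\<dots> = (\<integral>\<^sup>+r. (ennreal B * ennreal (ppow (\<eta> / 2 - 1) t)) * (ennreal (ppow (s - 1) (r - t) * r powr l) * N r) \<partial>lborel)"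
        by (rule nn_integral_cmult[symmetric]) measurable
      also have "\<dots> = (\<integral>\<^sup>+r. ennreal B * (ennreal (ppow (\<eta> / 2 - 1) t * ppow (s - 1) (r - t)) * (ennreal (r powr l) * N r)) \<partial>lborel)"
        by (simp add: ennreal_mult' mult.assoc)
      finally show ?thesis .
    qed (simp add: ppow_nonpos)
  qed
  also have "\<dots> = (\<integral>\<^sup>+r. \<integral>\<^sup>+t. ennreal B * (ennreal (ppow (\<eta> / 2 - 1) t * ppow (s - 1) (r - t)) * (ennreal (r powr l) * N r)) \<partial>lborel \<partial>lborel)"
    by (rule lborel_pair.Fubini') measurable
  also have "\<dots> = (\<integral>\<^sup>+r. ennreal (B\<^sup>2) * (ennreal (ppow (2 * s + \<eta> - 1) r) * N r) \<partial>lborel)"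
  proof (rule nn_integral_cong)
    fix r :: real
    have "(\<integral>\<^sup>+t. ennreal B * (ennreal (ppow (\<eta> / 2 - 1) t * ppow (s - 1) (r - t)) * (ennreal (r powr l) * N r)) \<partial>lborel)
      = ennreal B * ((\<integral>\<^sup>+t. ennreal (ppow (\<eta> / 2 - 1) t * ppow (s - 1) (r - t)) \<partial>lborel) * (ennreal (r powr l) * N r))"
      by (simp add: nn_integral_cmult nn_integral_multc)
    also have "\<dots> = ennreal (B\<^sup>2) * (ennreal (ppow (2 * s + \<eta> - 1) r) * N r)"
    proof (cases "0 < r")
      case True
      have e: "(\<integral>\<^sup>+t. ennreal (ppow (\<eta> / 2 - 1) t * ppow (s - 1) (r - t)) \<partial>lborel) = ennreal (B * r powr (\<eta> / 2 + s - 1))"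
        using nn_integral_Beta[of "\<eta> / 2" s r] s \<eta> True by (simp add: B_def Beta_commute)
      have "(\<eta> / 2 + s - 1) + l = 2 * s + \<eta> - 1"
        by (simp add: l_def)
      then have "r powr (\<eta> / 2 + s - 1) * r powr l = r powr (2 * s + \<eta> - 1)"
        by (simp only: powr_add[symmetric])
      then have "B * (B * r powr (\<eta> / 2 + s - 1) * r powr l) = B\<^sup>2 * ppow (2 * s + \<eta> - 1) r"
        using True by (simp add: ppow_pos power2_eq_square mult.assoc)
      then have "ennreal B * (ennreal (B * r powr (\<eta> / 2 + s - 1)) * ennreal (r powr l)) = ennreal (B\<^sup>2) * ennreal (ppow (2 * s + \<eta> - 1) r)"
        using B by (simp add: ennreal_mult'[symmetric])
      then show ?thesis
        unfolding e by (simp only: mult.assoc[symmetric])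
    next
      case False
      then have "ppow (\<eta> / 2 - 1) t * ppow (s - 1) (r - t) = 0" for t
        by (auto simp: ppow_def)
      then have "(\<integral>\<^sup>+t. ennreal (ppow (\<eta> / 2 - 1) t * ppow (s - 1) (r - t)) \<partial>lborel) = 0"
        by (simp only:) simp
      then show ?thesis using False by (simp add: ppow_nonpos)
    qed
    finally show "(\<integral>\<^sup>+t. ennreal B * (ennreal (ppow (\<eta> / 2 - 1) t * ppow (s - 1) (r - t)) * (ennreal (r powr l) * N r)) \<partial>lborel)
      = ennreal (B\<^sup>2) * (ennreal (ppow (2 * s + \<eta> - 1) r) * N r)" .
  qed
  also have "\<dots> = ennreal (B\<^sup>2) * (\<integral>\<^sup>+r. ennreal (ppow (2 * s + \<eta> - 1) r) * N r \<partial>lborel)"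
    by (rule nn_integral_cmult) measurable
  finally have main: "ennreal (g\<^sup>2) * X \<le> ennreal (B\<^sup>2) * Y"
    if "X = (\<integral>\<^sup>+t. ennreal (ppow (\<eta> - 1) t) * (\<integral>\<^sup>+x. ennreal (heat_kernel t x) * (u (x, t))\<^sup>2 \<partial>lborel) \<partial>lborel)"
      "Y = (\<integral>\<^sup>+r. ennreal (ppow (2 * s + \<eta> - 1) r) * N r \<partial>lborel)" for X Y
    using that by simp
  have "X \<le> ennreal ((Gamma (\<eta> / 2) / Gamma (s + \<eta> / 2))\<^sup>2) * Y" if "ennreal (g\<^sup>2) * X \<le> ennreal (B\<^sup>2) * Y" for X Y
  proof -
    have "X = ennreal (inverse (g\<^sup>2)) * (ennreal (g\<^sup>2) * X)"
      using g by (simp add: mult.assoc[symmetric] ennreal_mult'[symmetric])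
    also have "\<dots> \<le> ennreal (inverse (g\<^sup>2)) * (ennreal (B\<^sup>2) * Y)"
      using that by (rule mult_left_mono) simp
    also have "\<dots> = ennreal (inverse (g\<^sup>2) * B\<^sup>2) * Y"
      using g by (simp add: mult.assoc[symmetric] ennreal_mult'[symmetric])
    also have "inverse (g\<^sup>2) * B\<^sup>2 = (Gamma (\<eta> / 2) / Gamma (s + \<eta> / 2))\<^sup>2"
      using g by (simp add: B_def Beta_def g_def power_mult_distrib power_divide field_simps)
    finally show ?thesis .
  qed
  from this[OF main[OF refl refl]] show ?thesis
    unfolding N_def .
qed

lemma gaussian_weight:
  fixes x :: "'a::euclidean_space"
  assumes "0 < t"
  shows "exp (- (norm x)\<^sup>2 / (4 * t)) * t powr (a - 1 - real DIM('a) / 2)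
    = (4 * pi) powr (real DIM('a) / 2) * (ppow (a - 1) t * heat_kernel t x)"
proof -
  have "(4 * pi * t) powr (real DIM('a) / 2) = (4 * pi) powr (real DIM('a) / 2) * t powr (real DIM('a) / 2)"
    using assms by (simp add: powr_mult)
  then show ?thesis
    using assms by (simp add: heat_kernel_def ppow_pos powr_diff)
qed

lemma gaussian_weighted_norm:
  fixes f :: "'a::euclidean_space \<times> real \<Rightarrow> real"
  assumes [measurable]: "f \<in> borel_measurable (borel \<Otimes>\<^sub>M borel)"
  shows "(\<integral>\<^sup>+x. (\<integral>\<^sup>+t\<in>{0<..}. ennreal (\<bar>f (x, t)\<bar>\<^sup>2 * exp (- (norm x)\<^sup>2 / (4 * t)) * t powr (a - 1 - real DIM('a) / 2)) \<partial>lborel) \<partial>lborel)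
    = ennreal ((4 * pi) powr (real DIM('a) / 2)) *
      (\<integral>\<^sup>+t. ennreal (ppow (a - 1) t) * (\<integral>\<^sup>+x. ennreal (heat_kernel t x) * (ennreal \<bar>f (x, t)\<bar>)\<^sup>2 \<partial>lborel) \<partial>lborel)"
proof -
  let ?c = "ennreal ((4 * pi) powr (real DIM('a) / 2))"
  have "(\<integral>\<^sup>+x. (\<integral>\<^sup>+t\<in>{0<..}. ennreal (\<bar>f (x, t)\<bar>\<^sup>2 * exp (- (norm x)\<^sup>2 / (4 * t)) * t powr (a - 1 - real DIM('a) / 2)) \<partial>lborel) \<partial>lborel)
    = (\<integral>\<^sup>+x. \<integral>\<^sup>+t. ?c * (ennreal (ppow (a - 1) t) * (ennreal (heat_kernel t x) * (ennreal \<bar>f (x, t)\<bar>)\<^sup>2)) \<partial>lborel \<partial>lborel)"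
  proof (intro nn_integral_cong)
    fix x :: 'a and t :: real
    show "ennreal (\<bar>f (x, t)\<bar>\<^sup>2 * exp (- (norm x)\<^sup>2 / (4 * t)) * t powr (a - 1 - real DIM('a) / 2)) * indicator {0<..} t
      = ?c * (ennreal (ppow (a - 1) t) * (ennreal (heat_kernel t x) * (ennreal \<bar>f (x, t)\<bar>)\<^sup>2))"
    proof (cases "0 < t")
      case True
      have "ennreal (\<bar>f (x, t)\<bar>\<^sup>2 * exp (- (norm x)\<^sup>2 / (4 * t)) * t powr (a - 1 - real DIM('a) / 2))
        = ennreal (((4 * pi) powr (real DIM('a) / 2) * (ppow (a - 1) t * heat_kernel t x)) * \<bar>f (x, t)\<bar>\<^sup>2)"
        unfolding gaussian_weight[OF True, symmetric] by (simp only: mult_ac)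
      also have "\<dots> = ?c * (ennreal (ppow (a - 1) t) * (ennreal (heat_kernel t x) * (ennreal \<bar>f (x, t)\<bar>)\<^sup>2))"
        by (simp add: ennreal_mult' ennreal_power mult.assoc)
      finally show ?thesis using True by simp
    qed (simp add: ppow_nonpos)
  qed
  also have "\<dots> = (\<integral>\<^sup>+t. \<integral>\<^sup>+x. ?c * (ennreal (ppow (a - 1) t) * (ennreal (heat_kernel t x) * (ennreal \<bar>f (x, t)\<bar>)\<^sup>2)) \<partial>lborel \<partial>lborel)"
    by (rule lborel_pair.Fubini') measurable
  also have "\<dots> = ?c * (\<integral>\<^sup>+t. ennreal (ppow (a - 1) t) * (\<integral>\<^sup>+x. ennreal (heat_kernel t x) * (ennreal \<bar>f (x, t)\<bar>)\<^sup>2 \<partial>lborel) \<partial>lborel)"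
    by (simp add: nn_integral_cmult)
  finally show ?thesis .
qed

lemma hardy_const_ge:
  "(Gamma (\<eta> / 2) / Gamma (s + \<eta> / 2))\<^sup>2 \<le> hardy_const s \<eta>"
proof -
  have "(Gamma (\<eta> / 2) / Gamma (s + \<eta> / 2))\<^sup>2 = (Gamma ((\<eta> + real 0) / 2) / Gamma ((2 * s + \<eta> + real 0) / 2))\<^sup>2"
    by (simp add: add_divide_distrib)
  then show ?thesis
    unfolding hardy_const_def by (intro Max_ge) (auto intro!: image_eqI[of _ _ 0])
qed

theorem theorem1p1:
  fixes u :: "(real^'d) \<Rightarrow> real \<Rightarrow> real" and s \<eta> :: real
  assumes "0 < s" and "s < 1" and "0 < \<eta>"
    and "2 * s + \<eta> \<notin> \<nat>"
    and "even_extension u \<in> schwartz_space"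
  shows "(\<integral>\<^sup>+x. (\<integral>\<^sup>+t\<in>{0<..}.
            ennreal (\<bar>u x t\<bar>\<^sup>2 * exp (- (norm x)\<^sup>2 / (4 * t))
              * t powr ((2 * \<eta> - real CARD('d) - 2) / 2)) \<partial>lborel) \<partial>lborel)
       \<le> ennreal (hardy_const s \<eta>) *
         (\<integral>\<^sup>+x. (\<integral>\<^sup>+t\<in>{0<..}.
            ennreal (\<bar>frac_backward_heat s u x t\<bar>\<^sup>2 * exp (- (norm x)\<^sup>2 / (4 * t))
              * t powr (2 * s + (2 * \<eta> - real CARD('d) - 2) / 2)) \<partial>lborel) \<partial>lborel)"
proof -
  define U where "U = even_extension u"
  obtain K where "decaying_C2 U (\<lambda>p. frechet_derivative U (at p)) K"
    using schwartz_decaying_C2 assms(5) unfolding U_def by blast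
  then interpret decaying_C2 U "\<lambda>p. frechet_derivative U (at p)" K .
  have u: "u x t = U (x, t)" if "0 \<le> t" for x t
    using that by (simp add: U_def even_extension_def)
  have ext: "heat_extension u x t \<tau> = heat_ext x t \<tau>" if "0 < t" "0 < \<tau>" for x t \<tau>
    using that by (simp add: heat_extension_def heat_ext_def heat_kernel_def u)
  have frac: "frac_backward_heat s u x t = frac_power s x t" if "0 < t" for x t
  proof -
    have "(LINT \<tau>:{0<..}|lborel. (heat_extension u x t \<tau> - u x t) / \<tau> powr (1 + s))
      = (LINT \<tau>|lborel. ppow (-1 - s) \<tau> * (heat_ext x t \<tau> - U (x, t)))"
      unfolding set_lebesgue_integral_def
    proof (intro Bochner_Integration.integral_cong refl)
      fix \<tau> :: real
      have "\<tau> powr (-1 - s) = 1 / \<tau> powr (1 + s)"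
        using powr_minus_divide[of \<tau> "1 + s"] by simp
      then show "indicat_real {0<..} \<tau> *\<^sub>R ((heat_extension u x t \<tau> - u x t) / \<tau> powr (1 + s))
          = ppow (-1 - s) \<tau> * (heat_ext x t \<tau> - U (x, t))"
        using that by (cases "0 < \<tau>") (simp_all add: ext u ppow_def)
    qed
    then show ?thesis by (simp add: frac_backward_heat_def frac_power_def)
  qed
  define f where "f = (\<lambda>(x, t). frac_power s x t)"
  have [measurable]: "f \<in> borel_measurable (borel \<Otimes>\<^sub>M borel)"
    unfolding f_def by measurable
  have [measurable]: "U \<in> borel_measurable (borel \<Otimes>\<^sub>M borel)"
    unfolding borel_prod using U_continuous by (rule borel_measurable_continuous_onI)
  let ?p = "real DIM(real^'d) / 2"
  let ?X = "\<integral>\<^sup>+t. ennreal (ppow (\<eta> - 1) t) * (\<integral>\<^sup>+x. ennreal (heat_kernel t x) * (ennreal \<bar>U (x, t)\<bar>)\<^sup>2 \<partial>lborel) \<partial>lborel"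
  let ?Y = "\<integral>\<^sup>+t. ennreal (ppow (2 * s + \<eta> - 1) t) * (\<integral>\<^sup>+x. ennreal (heat_kernel t x) * (ennreal \<bar>f (x, t)\<bar>)\<^sup>2 \<partial>lborel) \<partial>lborel"
  have "?X \<le> ennreal ((Gamma (\<eta> / 2) / Gamma (s + \<eta> / 2))\<^sup>2) * ?Y"
  proof (rule fractional_Hardy[OF assms(1,3)])
    show "ennreal (Gamma s) * ennreal \<bar>U (x, t)\<bar> \<le> (\<integral>\<^sup>+\<sigma>. ennreal (ppow (s - 1) \<sigma>) *
      (\<integral>\<^sup>+y. ennreal (heat_kernel \<sigma> y) * ennreal \<bar>f (x - y, t + \<sigma>)\<bar> \<partial>lborel) \<partial>lborel)" if "0 < t" for x t
      using pointwise_bound[OF assms(1,2), of t x] that by (simp add: f_def ennreal_mult'')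
  qed measurable
  also have "\<dots> \<le> ennreal (hardy_const s \<eta>) * ?Y"
    by (intro mult_right_mono ennreal_leI hardy_const_ge) simp
  finally have main: "ennreal ((4 * pi) powr ?p) * ?X \<le> ennreal (hardy_const s \<eta>) * (ennreal ((4 * pi) powr ?p) * ?Y)"
    by (subst mult.left_commute) (rule mult_left_mono, simp_all)
  have e1: "(2 * \<eta> - real CARD('d) - 2) / 2 = \<eta> - 1 - real DIM(real^'d) / 2"
    by (simp add: field_simps)
  then have e2: "2 * s + (2 * \<eta> - real CARD('d) - 2) / 2 = 2 * s + \<eta> - 1 - real DIM(real^'d) / 2"
    by (simp only: diff_conv_add_uminus add.assoc)
  have "(\<integral>\<^sup>+x. (\<integral>\<^sup>+t\<in>{0<..}. ennreal (\<bar>u x t\<bar>\<^sup>2 * exp (- (norm x)\<^sup>2 / (4 * t))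
          * t powr ((2 * \<eta> - real CARD('d) - 2) / 2)) \<partial>lborel) \<partial>lborel)
    = ennreal ((4 * pi) powr ?p) * ?X"
    unfolding gaussian_weighted_norm[of U \<eta>, symmetric, OF \<open>U \<in> _\<close>]
    unfolding e1 by (intro nn_integral_cong) (auto simp: u split: split_indicator)
  moreover have "(\<integral>\<^sup>+x. (\<integral>\<^sup>+t\<in>{0<..}. ennreal (\<bar>frac_backward_heat s u x t\<bar>\<^sup>2 * exp (- (norm x)\<^sup>2 / (4 * t))
          * t powr (2 * s + (2 * \<eta> - real CARD('d) - 2) / 2)) \<partial>lborel) \<partial>lborel)
    = ennreal ((4 * pi) powr ?p) * ?Y"
    unfolding gaussian_weighted_norm[of f "2 * s + \<eta>", symmetric, OF \<open>f \<in> _\<close>]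
    unfolding e2 by (intro nn_integral_cong) (auto simp: frac f_def split: split_indicator)
  ultimately show ?thesis
    using main by simp
qed

end
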